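(* (i) Every semi-magic Sudoku board can be transformed by an element of $H_\Gamma$ into a semi-magic Sudoku board whose gnomon is the standard gnomon. (ii) There are exactly sixteen $H_\Gamma$-nests of semi-magic Sudoku boards, and each $H_\Gamma$-nest contains exactly one semi-magic Sudoku board whose gnomon is the standard gnomon.
   Context: A Sudoku board is a $9\times 9$ array with entries from $\{0,\dots,8\}$, rows indexed $1,\dots,9$ top to bottom and columns $1,\dots,9$ left to right, such that every row, every column, and every $3\times3$ block (rows $3a+1,\dots,3a+3$, columns $3b+1,\dots,3b+3$) contains each symbol exactly once. A semi-magic Sudoku board is a Sudoku board in which, in every block, each of the three rows and each of the three columns of the block has entry sum $12$. Bands are the three horizontal strips of blocks (rows 1–3, 4–6, 7–9); pillars are the three vertical strips (columns 1–3, 4–6, 7–9). The gnomon of a board is the union of its first band and its first pillar (rows 1–3 together with columns 1–3). The standard gnomon is the one with rows $1,2,3$ equal to $(0,4,8,7,2,3,5,6,1)$, $(5,6,1,0,4,8,7,2,3)$, $(7,2,3,5,6,1,0,4,8)$ and with the entries in columns $1,2,3$ of rows $4,\dots,9$ equal to $(8,0,4)$, $(1,5,6)$, $(3,7,2)$, $(4,8,0)$, $(6,1,5)$, $(2,3,7)$ respectively. $H_\Gamma$ is the group of cell rearrangements (acting on boards by moving entries) generated by the transpose, all swaps of two rows within the same band, all swaps of two columns within the same pillar, the swap of pillars 2 and 3, and the swap of bands 2 and 3. Two semi-magic boards are in the same $H_\Gamma$-nest if one can be obtained from the other by an element of $H_\Gamma$. *)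

theory Defs
  imports Main
begin

text \<open>A board is a function from cells (row, column) to entries. Rows and columns
are indexed 1..9; cells outside the grid are required to carry the entry 0, so that
a board is determined by its entries on the grid.\<close>

type_synonym board = "nat \<times> nat \<Rightarrow> nat"

definition grid :: "(nat \<times> nat) set" where
  "grid = {1..9} \<times> {1..9}"

definition block_cells :: "nat \<Rightarrow> nat \<Rightarrow> (nat \<times> nat) set" where
  "block_cells a c = {3*a+1..3*a+3} \<times> {3*c+1..3*c+3}"

definition sudoku :: "board \<Rightarrow> bool" where
  "sudoku b \<longleftrightarrow>
     (\<forall>x. x \<notin> grid \<longrightarrow> b x = 0) \<and>
     (\<forall>i\<in>{1..9}. (\<lambda>j. b (i, j)) ` {1..9} = {0..8}) \<and>
     (\<forall>j\<in>{1..9}. (\<lambda>i. b (i, j)) ` {1..9} = {0..8}) \<and>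
     (\<forall>a<3. \<forall>c<3. b ` block_cells a c = {0..8})"

definition semi_magic :: "board \<Rightarrow> bool" where
  "semi_magic b \<longleftrightarrow> sudoku b \<and>
     (\<forall>a<3. \<forall>c<3. \<forall>r<3.
        (\<Sum>k<3. b (3*a+r+1, 3*c+k+1)) = 12 \<and>
        (\<Sum>k<3. b (3*a+k+1, 3*c+r+1)) = 12)"

definition std_band :: "nat list list" where
  "std_band = [[0,4,8,7,2,3,5,6,1], [5,6,1,0,4,8,7,2,3], [7,2,3,5,6,1,0,4,8]]"

definition std_pillar :: "nat list list" where
  "std_pillar = [[8,0,4], [1,5,6], [3,7,2], [4,8,0], [6,1,5], [2,3,7]]"

definition gnomon :: "(nat \<times> nat) set" where
  "gnomon = ({1..3} \<times> {1..9}) \<union> ({1..9} \<times> {1..3})"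

definition std_gnomon_entry :: "nat \<times> nat \<Rightarrow> nat" where
  "std_gnomon_entry x = (case x of (i, j) \<Rightarrow>
     if i \<le> 3 then std_band ! (i - 1) ! (j - 1) else std_pillar ! (i - 4) ! (j - 1))"

definition has_std_gnomon :: "board \<Rightarrow> bool" where
  "has_std_gnomon b \<longleftrightarrow> (\<forall>x\<in>gnomon. b x = std_gnomon_entry x)"

text \<open>Cell rearrangements: permutations of cells fixing every cell outside the grid.
A rearrangement \<sigma> moves the entry at cell \<sigma> x to cell x, i.e. acts by b \<mapsto> b \<circ> \<sigma>.
Since the generators are involutions and the generated group is finite, the set
generated under composition is the group H_Gamma.\<close>

definition sw :: "nat \<Rightarrow> nat \<Rightarrow> nat \<Rightarrow> nat" where
  "sw p q x = (if x = p then q else if x = q then p else x)"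

definition on_grid :: "(nat \<times> nat \<Rightarrow> nat \<times> nat) \<Rightarrow> nat \<times> nat \<Rightarrow> nat \<times> nat" where
  "on_grid f x = (if x \<in> grid then f x else x)"

definition transpose_cells :: "nat \<times> nat \<Rightarrow> nat \<times> nat" where
  "transpose_cells = on_grid (\<lambda>(i, j). (j, i))"

definition row_swap :: "nat \<Rightarrow> nat \<Rightarrow> nat \<times> nat \<Rightarrow> nat \<times> nat" where
  "row_swap p q = on_grid (\<lambda>(i, j). (sw p q i, j))"

definition col_swap :: "nat \<Rightarrow> nat \<Rightarrow> nat \<times> nat \<Rightarrow> nat \<times> nat" where
  "col_swap p q = on_grid (\<lambda>(i, j). (i, sw p q j))"

definition strip23 :: "nat \<Rightarrow> nat" where
  "strip23 x = (if 4 \<le> x \<and> x \<le> 6 then x + 3 else if 7 \<le> x \<and> x \<le> 9 then x - 3 else x)"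

definition band_swap23 :: "nat \<times> nat \<Rightarrow> nat \<times> nat" where
  "band_swap23 = on_grid (\<lambda>(i, j). (strip23 i, j))"

definition pillar_swap23 :: "nat \<times> nat \<Rightarrow> nat \<times> nat" where
  "pillar_swap23 = on_grid (\<lambda>(i, j). (i, strip23 j))"

definition same_strip :: "nat \<Rightarrow> nat \<Rightarrow> bool" where
  "same_strip p q \<longleftrightarrow> p \<in> {1..9} \<and> q \<in> {1..9} \<and> (p - 1) div 3 = (q - 1) div 3"

definition H_gens :: "(nat \<times> nat \<Rightarrow> nat \<times> nat) set" where
  "H_gens = {transpose_cells, band_swap23, pillar_swap23}
     \<union> {row_swap p q | p q. same_strip p q}
     \<union> {col_swap p q | p q. same_strip p q}"

inductive_set H_Gamma :: "(nat \<times> nat \<Rightarrow> nat \<times> nat) set" where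
  H_id: "id \<in> H_Gamma"
| H_step: "g \<in> H_gens \<Longrightarrow> h \<in> H_Gamma \<Longrightarrow> g \<circ> h \<in> H_Gamma"

definition act :: "(nat \<times> nat \<Rightarrow> nat \<times> nat) \<Rightarrow> board \<Rightarrow> board" where
  "act \<sigma> b = b \<circ> \<sigma>"

definition semi_magic_boards :: "board set" where
  "semi_magic_boards = {b. semi_magic b}"

definition same_nest :: "(board \<times> board) set" where
  "same_nest = {(b, b'). semi_magic b \<and> semi_magic b' \<and> (\<exists>\<sigma>\<in>H_Gamma. b' = act \<sigma> b)}"

definition nests :: "board set set" where
  "nests = semi_magic_boards // same_nest"

end

theory Submission
  imports Defs "HOL-Combinatorics.Permutations" "HOL-Number_Theory.Cong"
begin

text \<open>In a semi-magic block the rows are the triples 048, 156, 237 and the columns the triples 057,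
  246, 138, or vice versa, and disjointness of triples forces the same alternative in all blocks of a
  board. After a transposition, a board is therefore given by two independent families of
  \<open>3 \<times> 3\<close> Latin squares: for each band the arrangement of the row triples, and for each pillar the
  arrangement of the column triples. A Latin square with first column 0, 1, 2 is one of the two
  squares \<open>r + e * c mod 3\<close> with \<open>e \<in> {1, 2}\<close>. Permuting rows and columns within strips
  normalizes the first columns of all squares, and the swap of pillars (bands) 2 and 3 normalizes
  \<open>e\<close> for the first band (pillar); this is exactly the standard gnomon. The four remaining choices of
  \<open>e\<close> give sixteen boards. They are inequivalent because an element of the group maps a standard board
  to a standard board only if it fixes every row and every column.\<close>

section \<open>Bands, pillars and transposition\<close>

definition strip :: "nat \<Rightarrow> nat set" where
  "strip a = {3*a+1..3*a+3}"

definition strip_of :: "nat \<Rightarrow> nat" where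
  "strip_of i = (i - 1) div 3"

lemma mem_strip: "i \<in> strip a \<longleftrightarrow> 1 \<le> i \<and> strip_of i = a"
  by (auto simp: strip_def strip_of_def)

lemma mem_range9: "i \<in> {1..9} \<longleftrightarrow> 1 \<le> i \<and> strip_of i < 3"
  by (auto simp: strip_of_def)

lemma mem_grid: "(i, j) \<in> grid \<longleftrightarrow> i \<in> {1..9} \<and> j \<in> {1..9}"
  by (simp add: grid_def)

lemma strip_subset: "a < 3 \<Longrightarrow> i \<in> strip a \<Longrightarrow> i \<in> {1..9}"
  by (simp add: strip_def)

lemma in_own_strip: "i \<in> {1..9} \<Longrightarrow> i \<in> strip (strip_of i)"
  by (simp add: mem_strip)

lemma strip_of_less: "i \<in> {1..9} \<Longrightarrow> strip_of i < 3"
  by (simp only: mem_range9)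

lemma UN_strips: "(\<Union>a<3. strip a) = {1..9}"
  by (auto simp: mem_strip strip_of_def)

lemma finite_strip [simp]: "finite (strip a)" and card_strip [simp]: "card (strip a) = 3"
  by (simp_all add: strip_def)

lemma lessThan_3: "{..<3} = {0, 1, 2::nat}"
  by auto

lemma sum_strip: "(\<Sum>i\<in>strip a. h i) = (\<Sum>k<3. h (3*a+k+1))"
proof -
  have "strip a = {3*a+1, 3*a+2, 3*a+3}" by (auto simp: strip_def)
  then show ?thesis by (simp add: lessThan_3 numeral_eq_Suc add.assoc)
qed

lemma ball_strip: "(\<forall>i\<in>strip a. P i) \<longleftrightarrow> (\<forall>r<3. P (3*a+r+1))"
proof -
  have "strip a = (\<lambda>r. 3*a+r+1) ` {..<3}"
    by (auto simp: strip_def image_def Bex_def) presburger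
  then show ?thesis by auto
qed

text \<open>The half of the semi-magic condition that concerns rows, together with the block
  condition. The column half is the same predicate on the transposed board, so that facts about rows
  yield facts about columns by transposition.\<close>

definition row_magic :: "board \<Rightarrow> bool" where
  "row_magic b \<longleftrightarrow>
     (\<forall>i\<in>{1..9}. (\<lambda>j. b (i, j)) ` {1..9} = {0..8}) \<and>
     (\<forall>i\<in>{1..9}. \<forall>c<3. (\<Sum>j\<in>strip c. b (i, j)) = 12) \<and>
     (\<forall>a<3. \<forall>c<3. b ` (strip a \<times> strip c) = {0..8})"

lemma transpose_cells_apply: "(i, j) \<in> grid \<Longrightarrow> transpose_cells (i, j) = (j, i)"
  by (simp add: transpose_cells_def on_grid_def)

lemma transpose_off_grid: "x \<notin> grid \<Longrightarrow> transpose_cells x = x"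
  by (simp add: transpose_cells_def on_grid_def)

lemma transpose_transpose [simp]: "transpose_cells \<circ> transpose_cells = id"
  by (auto simp: transpose_cells_def on_grid_def grid_def fun_eq_iff)

lemma transpose_transpose_board [simp]: "b \<circ> transpose_cells \<circ> transpose_cells = b"
  by (simp add: comp_assoc)

lemma transpose_block:
  assumes "a < 3" "c < 3"
  shows "transpose_cells ` (strip a \<times> strip c) = strip c \<times> strip a"
proof -
  have *: "transpose_cells (i, j) = (j, i)" if "i \<in> strip a" "j \<in> strip c" for i j
    using that assms by (intro transpose_cells_apply) (auto simp: mem_grid dest: strip_subset)
  have "transpose_cells ` (strip a \<times> strip c) = (\<lambda>(i, j). (j, i)) ` (strip a \<times> strip c)"
    by (intro image_cong) (auto simp: *)
  then show ?thesis by auto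
qed

lemma semi_magic_iff:
  "semi_magic b \<longleftrightarrow>
     (\<forall>x. x \<notin> grid \<longrightarrow> b x = 0) \<and> row_magic b \<and> row_magic (b \<circ> transpose_cells)"
proof -
  have blk: "block_cells a c = strip a \<times> strip c" for a c
    by (simp add: block_cells_def strip_def)
  have T: "(b \<circ> transpose_cells) (i, j) = b (j, i)" if "i \<in> {1..9}" "j \<in> {1..9}" for i j
    using that by (simp add: transpose_cells_apply mem_grid)
  have rows: "(\<lambda>j. (b \<circ> transpose_cells) (i, j)) ` {1..9} = (\<lambda>j. b (j, i)) ` {1..9}"
    if "i \<in> {1..9}" for i
    using that T by (intro image_cong) auto
  have sums: "(\<Sum>j\<in>strip c. (b \<circ> transpose_cells) (i, j)) = (\<Sum>j\<in>strip c. b (j, i))"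
    if "i \<in> {1..9}" "c < 3" for i c
    using that by (intro sum.cong refl T) (auto dest: strip_subset)
  have blocks: "(b \<circ> transpose_cells) ` (strip a \<times> strip c) = b ` (strip c \<times> strip a)"
    if "a < 3" "c < 3" for a c
    using that by (simp only: image_comp [symmetric] transpose_block)
  have range9: "(\<forall>i\<in>{1..9}. P i) \<longleftrightarrow> (\<forall>a<3. \<forall>i\<in>strip a. P i)" for P
    unfolding UN_strips [symmetric] by blast
  have magic: "(\<forall>a<3. \<forall>c<3. \<forall>r<3.
        (\<Sum>k<3. b (3*a+r+1, 3*c+k+1)) = 12 \<and> (\<Sum>k<3. b (3*a+k+1, 3*c+r+1)) = 12) \<longleftrightarrow>
      (\<forall>i\<in>{1..9}. \<forall>c<3. (\<Sum>j\<in>strip c. b (i, j)) = 12) \<and>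
      (\<forall>i\<in>{1..9}. \<forall>c<3. (\<Sum>j\<in>strip c. b (j, i)) = 12)"
    unfolding range9 ball_strip sum_strip by blast
  have "row_magic (b \<circ> transpose_cells) \<longleftrightarrow>
      (\<forall>i\<in>{1..9}. (\<lambda>j. b (j, i)) ` {1..9} = {0..8}) \<and>
      (\<forall>i\<in>{1..9}. \<forall>c<3. (\<Sum>j\<in>strip c. b (j, i)) = 12) \<and>
      (\<forall>a<3. \<forall>c<3. b ` (strip c \<times> strip a) = {0..8})"
    unfolding row_magic_def by (simp only: rows sums blocks cong: ball_cong imp_cong)
  moreover have "(\<forall>a<3. \<forall>c<3. b ` (strip c \<times> strip a) = {0..8}) \<longleftrightarrow>
      (\<forall>a<3. \<forall>c<3. b ` (strip a \<times> strip c) = {0..8})" by blast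
  ultimately show ?thesis
    unfolding semi_magic_def sudoku_def blk magic unfolding row_magic_def [of b] by argo
qed

lemma semi_magic_transpose: "semi_magic b \<Longrightarrow> semi_magic (b \<circ> transpose_cells)"
  by (simp add: semi_magic_iff comp_assoc transpose_off_grid del: transpose_transpose_board)

section \<open>Triples of symbols with sum 12\<close>

definition row_triples :: "nat set set" where
  "row_triples = {{0,4,8}, {1,5,6}, {2,3,7}}"

definition col_triples :: "nat set set" where
  "col_triples = {{0,5,7}, {2,4,6}, {1,3,8}}"

text \<open>In increasing order the first element is at most 3, the second at most 5, and the third
  is determined by the sum. In the square with rows 0 4 8, 5 6 1, 7 2 3 the two families are the
  rows and the columns, and the two exceptional triples are transversals.\<close>

lemma sum_12_triples:
  fixes X :: "nat set"
  assumes "X \<subseteq> {0..8}" "card X = 3" "\<Sum>X = 12"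
  shows "X \<in> row_triples \<union> col_triples \<union> {{1,4,7}, {3,4,5}}"
proof -
  obtain x y z where X: "X = {x, y, z}" "x < y" "y < z"
  proof -
    obtain x y z where "X = {x, y, z}" "x \<noteq> y" "y \<noteq> z" "x \<noteq> z"
      using assms(2) by (auto simp: card_3_iff)
    \<comment> \<open>All six ways of writing the set, set against the six possible orders of its
      elements: one of them is increasing.\<close>
    then have "X = {x,y,z} \<and> X = {x,z,y} \<and> X = {y,x,z} \<and> X = {y,z,x} \<and> X = {z,x,y} \<and> X = {z,y,x}"
      "x < y \<and> y < z \<or> x < z \<and> z < y \<or> y < x \<and> x < z \<or> y < z \<and> z < x \<or> z < x \<and> x < y \<or> z < y \<and> y < x"
      by auto
    then show ?thesis using that by metis
  qed
  have z: "z = 12 - x - y" and "x + y + z = 12" "z \<le> 8" using assms X by auto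
  then have "x \<in> {0,1,2,3}" "y \<in> {1,2,3,4,5}" using X(2,3) by auto
  with X z \<open>z \<le> 8\<close> show ?thesis
    by (elim insertE emptyE) (simp_all add: row_triples_def col_triples_def)
qed

lemma zero_in_block:
  assumes "row_magic b" "a < 3" "c < 3"
  obtains i j where "i \<in> strip a" "j \<in> strip c" "b (i, j) = 0"
proof -
  have "0 \<in> b ` (strip a \<times> strip c)" using assms by (simp add: row_magic_def)
  then obtain x where "x \<in> strip a \<times> strip c" "b x = 0" by force
  then show ?thesis using that [of "fst x" "snd x"] by auto
qed

text \<open>The symbol 0 lies in one triple of each family and in neither exceptional triple, so a
  segment through 0 belongs to a family and is known exactly. Hence 0 serves as the probe symbol
  below.\<close>

lemma triples_of_zero:
  assumes "0 \<in> X"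
  shows "X \<in> row_triples \<Longrightarrow> X = {0,4,8}" "X \<in> col_triples \<Longrightarrow> X = {0,5,7}"
    "X \<in> row_triples \<union> col_triples \<union> {{1,4,7}, {3,4,5}} \<Longrightarrow> X \<in> row_triples \<or> X \<in> col_triples"
proof -
  show "X \<in> row_triples \<Longrightarrow> X = {0,4,8}" "X \<in> col_triples \<Longrightarrow> X = {0,5,7}"
    using assms by (auto simp: row_triples_def col_triples_def)
  have "X \<noteq> {1,4,7}" "X \<noteq> {3,4,5}" using assms by auto
  then show "X \<in> row_triples \<union> col_triples \<union> {{1,4,7}, {3,4,5}} \<Longrightarrow> X \<in> row_triples \<or> X \<in> col_triples"
    by blast
qed

section \<open>Row segments of blocks and the family they belong to\<close>

definition row_set :: "board \<Rightarrow> nat \<Rightarrow> nat \<Rightarrow> nat set" where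
  "row_set b i c = (\<lambda>j. b (i, j)) ` strip c"

lemma row_inj:
  assumes "row_magic b" "i \<in> {1..9}"
  shows "inj_on (\<lambda>j. b (i, j)) {1..9}"
proof (rule eq_card_imp_inj_on)
  have "(\<lambda>j. b (i, j)) ` {1..9} = {0..8}" using assms by (simp add: row_magic_def)
  then show "card ((\<lambda>j. b (i, j)) ` {1..9}) = card {1..9::nat}" by simp
qed simp

lemma block_inj:
  assumes "row_magic b" "a < 3" "c < 3"
  shows "inj_on b (strip a \<times> strip c)"
proof (rule eq_card_imp_inj_on)
  have "b ` (strip a \<times> strip c) = {0..8}" using assms by (simp add: row_magic_def)
  then show "card (b ` (strip a \<times> strip c)) = card (strip a \<times> strip c)"
    by (simp add: card_cartesian_product)
qed simp

lemma row_set_cases: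
  assumes "row_magic b" "i \<in> {1..9}" "c < 3"
  shows "row_set b i c \<in> row_triples \<union> col_triples \<union> {{1,4,7}, {3,4,5}}"
proof (rule sum_12_triples)
  have inj: "inj_on (\<lambda>j. b (i, j)) (strip c)"
    using row_inj [OF assms(1,2)] assms(3) strip_subset by (blast intro: inj_on_subset)
  have "(\<lambda>j. b (i, j)) ` {1..9} = {0..8}" using assms by (simp add: row_magic_def)
  then show "row_set b i c \<subseteq> {0..8}"
    using assms(3) strip_subset unfolding row_set_def by blast
  show "card (row_set b i c) = 3" "\<Sum>(row_set b i c) = 12"
    using assms unfolding row_set_def
    by (simp_all add: card_image [OF inj] sum.reindex [OF inj] row_magic_def)
qed

lemma row_set_disjoint_row:
  assumes "row_magic b" "i \<in> {1..9}" "c < 3" "c' < 3" "c \<noteq> c'"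
  shows "row_set b i c \<inter> row_set b i c' = {}"
proof -
  have "strip c \<inter> strip c' = {}" using assms(5) by (auto simp: mem_strip)
  moreover have "strip c \<subseteq> {1..9}" "strip c' \<subseteq> {1..9}" using assms(3,4) strip_subset by blast+
  ultimately show ?thesis
    unfolding row_set_def using inj_on_image_Int [OF row_inj [OF assms(1,2)]] by (metis image_empty)
qed

lemma row_set_disjoint_block:
  assumes "row_magic b" "a < 3" "c < 3" "i \<in> strip a" "i' \<in> strip a" "i \<noteq> i'"
  shows "row_set b i c \<inter> row_set b i' c = {}"
proof -
  have "b (i, j) \<noteq> b (i', j')" if "j \<in> strip c" "j' \<in> strip c" for j j'
    using inj_onD [OF block_inj [OF assms(1-3)], of "(i, j)" "(i', j')"] assms(4-6) that by auto
  then show ?thesis unfolding row_set_def by blast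
qed

text \<open>Names the two families in either order, so that one argument covers both alternatives
  for the rows of a board.\<close>

definition dual_triples :: "nat set set \<Rightarrow> nat set set \<Rightarrow> bool" where
  "dual_triples A B \<longleftrightarrow>
     A = row_triples \<and> B = col_triples \<or> A = col_triples \<and> B = row_triples"

text \<open>A row triple meets every column triple and both exceptional triples, so a triple with
  sum 12 that is disjoint from it is another row triple. The same holds with the families
  exchanged.\<close>

lemma disjoint_triple:
  assumes "dual_triples A B" "X \<in> A" "X \<inter> Y = {}"
    "Y \<in> row_triples \<union> col_triples \<union> {{1,4,7}, {3,4,5}}"
  shows "Y \<in> A"
proof -
  have X: "X = {0,4,8} \<or> X = {1,5,6} \<or> X = {2,3,7}" if "A = row_triples"
    using assms(2) that by (simp add: row_triples_def)
  have X': "X = {0,5,7} \<or> X = {2,4,6} \<or> X = {1,3,8}" if "A = col_triples"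
    using assms(2) that by (simp add: col_triples_def)
  have Y: "Y \<in> row_triples \<or> Y = {0,5,7} \<or> Y = {2,4,6} \<or> Y = {1,3,8} \<or> Y = {1,4,7} \<or> Y = {3,4,5}"
    using assms(4) unfolding col_triples_def Un_iff insert_iff empty_iff by argo
  have Y': "Y \<in> col_triples \<or> Y = {0,4,8} \<or> Y = {1,5,6} \<or> Y = {2,3,7} \<or> Y = {1,4,7} \<or> Y = {3,4,5}"
    using assms(4) unfolding row_triples_def Un_iff insert_iff empty_iff by argo
  show ?thesis
  proof (cases "A = row_triples")
    case True
    from X [OF True] Y assms(3) True show ?thesis by (elim disjE) simp_all
  next
    case False
    then have "A = col_triples" using assms(1) by (auto simp: dual_triples_def)
    from X' [OF this] Y' assms(3) this show ?thesis by (elim disjE) simp_all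
  qed
qed

text \<open>Disjointness of segments passes the family on, first along row \<open>i\<close> to
  pillar \<open>c'\<close>, then inside the block reached there to row \<open>i'\<close>.\<close>

lemma row_set_spread:
  assumes b: "row_magic b" and AB: "dual_triples A B"
    and "a < 3" "c < 3" "c' < 3" "i \<in> strip a" "i' \<in> strip a" "row_set b i c \<in> A"
  shows "row_set b i' c' \<in> A"
proof -
  have i: "i \<in> {1..9}" "i' \<in> {1..9}" using assms strip_subset by blast+
  have "row_set b i c' \<in> A"
    using disjoint_triple [OF AB assms(8) row_set_disjoint_row [OF b i(1) assms(4,5)]]
      row_set_cases [OF b i(1) assms(5)] assms(8) by metis
  then show ?thesis
    using disjoint_triple [OF AB _ row_set_disjoint_block [OF b assms(3,5,6,7)]]
      row_set_cases [OF b i(2) assms(5)] by metis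
qed

text \<open>The symbol 0 lies in exactly one triple of each family. If the rows of a block come from one
  family, then the column through 0 meets the row through 0 in 0 only, so it comes from the other.\<close>

lemma cross_spread:
  assumes b: "semi_magic b" and AB: "dual_triples A B"
    and "a < 3" "c < 3" "i \<in> strip a" "row_set b i c \<in> A" "j \<in> strip c" "a' < 3"
  shows "row_set (b \<circ> transpose_cells) j a' \<in> B"
proof -
  have bm: "row_magic b" "row_magic (b \<circ> transpose_cells)" using b by (auto simp: semi_magic_iff)
  obtain i0 j0 where 0: "i0 \<in> strip a" "j0 \<in> strip c" "b (i0, j0) = 0"
    using zero_in_block [OF bm(1) assms(3,4)] .
  have j0: "j0 \<in> {1..9}" using 0 assms(4) strip_subset by blast
  have T: "(b \<circ> transpose_cells) (j0, i) = b (i, j0)" if "i \<in> strip a" for i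
    using that j0 strip_subset [OF assms(3)] by (simp add: transpose_cells_apply mem_grid)
  have col: "row_set (b \<circ> transpose_cells) j0 a = (\<lambda>i. b (i, j0)) ` strip a"
    unfolding row_set_def by (intro image_cong refl T)
  have meet: "x = 0" if x: "x \<in> row_set b i0 c" "x \<in> row_set (b \<circ> transpose_cells) j0 a" for x
  proof -
    obtain j where j: "j \<in> strip c" "x = b (i0, j)" using x(1) by (auto simp: row_set_def)
    obtain i where i: "i \<in> strip a" "x = b (i, j0)" using x(2) by (auto simp: col)
    have "(i0, j) = (i, j0)"
      using inj_onD [OF block_inj [OF bm(1) assms(3,4)], of "(i0, j)" "(i, j0)"] i j 0 by simp
    then show "x = 0" using i 0 by simp
  qed
  have "0 \<in> row_set b i0 c" "0 \<in> row_set (b \<circ> transpose_cells) j0 a"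
    using 0 by (force simp: row_set_def, force simp: col)
  moreover have "row_set b i0 c \<in> A"
    using row_set_spread [OF bm(1) AB assms(3,4,4,5) 0(1) assms(6)] .
  moreover have "i0 \<in> {1..9}" using 0 assms(3) strip_subset by blast
  \<comment> \<open>Each family has a single triple through 0. If the row and the column through 0
    used the same family, they would coincide and share 4 or 5 besides 0.\<close>
  moreover have "\<not> {0, x} \<subseteq> row_set b i0 c \<inter> row_set (b \<circ> transpose_cells) j0 a" if "x \<noteq> 0" for x
    using that meet by blast
  from this [of 4] this [of 5]
  have "\<not> (row_set b i0 c = {0,4,8} \<and> row_set (b \<circ> transpose_cells) j0 a = {0,4,8})"
    "\<not> (row_set b i0 c = {0,5,7} \<and> row_set (b \<circ> transpose_cells) j0 a = {0,5,7})"
    by auto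
  ultimately have "row_set (b \<circ> transpose_cells) j0 a \<in> B"
    using AB triples_of_zero [of "row_set b i0 c"] row_set_cases [OF bm(2) j0 assms(3)]
      triples_of_zero [of "row_set (b \<circ> transpose_cells) j0 a"]
    unfolding dual_triples_def by metis
  moreover have "dual_triples B A" using AB by (auto simp: dual_triples_def)
  ultimately show ?thesis
    using row_set_spread [OF bm(2) _ assms(4,3,8) 0(2) assms(7)] by blast
qed

text \<open>The family spreads along the first band and crosses from there to the columns. The rows
  follow by crossing once more, now from the transposed board, whose transpose is \<open>b\<close>
  again.\<close>

lemma all_triples:
  assumes b: "semi_magic b" and AB: "dual_triples A B"
    and "i0 \<in> strip 0" "row_set b i0 0 \<in> A" "i \<in> {1..9}" "c < 3"
  shows "row_set b i c \<in> A" "row_set (b \<circ> transpose_cells) i c \<in> B"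
proof -
  have bm: "row_magic b" using b by (auto simp: semi_magic_iff)
  have *: "row_set (b \<circ> transpose_cells) j c' \<in> B" if "j \<in> {1..9}" "c' < 3" for j c'
  proof (rule cross_spread [OF b AB _ _ assms(3)])
    show "row_set b i0 (strip_of j) \<in> A"
      using row_set_spread [OF bm AB _ _ _ assms(3,3,4)] strip_of_less that by simp
  qed (use that in_own_strip strip_of_less in \<open>auto simp del: atLeastAtMost_iff\<close>)
  then show "row_set (b \<circ> transpose_cells) i c \<in> B" using assms by blast
  have BA: "dual_triples B A" using AB by (auto simp: dual_triples_def)
  have "row_set (b \<circ> transpose_cells \<circ> transpose_cells) i c \<in> A"
  proof (rule cross_spread [OF semi_magic_transpose [OF b] BA])
    show "1 \<in> strip 0" by (simp add: strip_def)
    show "row_set (b \<circ> transpose_cells) 1 (strip_of i) \<in> B"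
      using * strip_of_less assms by simp
  qed (use assms in_own_strip strip_of_less in \<open>auto simp del: atLeastAtMost_iff\<close>)
  then show "row_set b i c \<in> A" by simp
qed

text \<open>The segment through 0 in the first block belongs to a family. If that is the column
  family, the columns carry row triples, which are the rows of the transposed board.\<close>

lemma row_triples_or_transpose:
  assumes "semi_magic b"
  obtains i where "i \<in> strip 0" "row_set b i 0 \<in> row_triples"
  | i where "i \<in> strip 0" "row_set (b \<circ> transpose_cells) i 0 \<in> row_triples"
proof -
  have bm: "row_magic b" using assms by (auto simp: semi_magic_iff)
  obtain i j where 0: "i \<in> strip 0" "j \<in> strip 0" "b (i, j) = 0"
    using zero_in_block [OF bm, of 0 0] by auto
  then have "i \<in> {1..9}" using strip_subset [of 0 i] by simp
  moreover have "0 \<in> row_set b i 0" using 0 by (force simp: row_set_def)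
  moreover have "row_set b i 0 \<in> row_triples \<union> col_triples \<union> {{1,4,7}, {3,4,5}}"
    using \<open>i \<in> {1..9}\<close> by (intro row_set_cases [OF bm]) simp_all
  ultimately have "row_set b i 0 \<in> row_triples \<or> row_set b i 0 \<in> col_triples"
    using triples_of_zero by blast
  then show ?thesis
  proof
    assume "row_set b i 0 \<in> col_triples"
    then have "row_set (b \<circ> transpose_cells) i 0 \<in> row_triples"
      using all_triples(2) [OF assms, of col_triples row_triples i i 0] 0 \<open>i \<in> {1..9}\<close>
      by (simp add: dual_triples_def)
    with 0 that show ?thesis by blast
  qed (use 0 that in blast)
qed

section \<open>Boards as pairs of Latin families\<close>

text \<open>Table of the index of the row triple through \<open>x\<close>, in the order listed in
  \<open>row_triples\<close>. With \<open>col_class\<close> it gives the coordinates of a symbol in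
  the square \<open>symb\<close>.\<close>

definition row_class :: "nat \<Rightarrow> nat" where
  "row_class x = [0,1,2,2,0,1,1,2,0] ! x"

definition col_class :: "nat \<Rightarrow> nat" where
  "col_class x = [0,2,1,2,1,0,1,0,2] ! x"

text \<open>The top left block of the standard gnomon, so that in this block the two triple indices
  of a cell are its row and column positions counted from 0.\<close>

definition symb :: "nat \<Rightarrow> nat \<Rightarrow> nat" where
  "symb r k = [[0,4,8], [5,6,1], [7,2,3]] ! r ! k"

lemma less_3_cases: "(x::nat) < 3 \<longleftrightarrow> x = 0 \<or> x = 1 \<or> x = 2"
  by auto

lemma le_8_cases: "(x::nat) \<le> 8 \<longleftrightarrow>
    x = 0 \<or> x = 1 \<or> x = 2 \<or> x = 3 \<or> x = 4 \<or> x = 5 \<or> x = 6 \<or> x = 7 \<or> x = 8"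
  by auto

lemma symb_of_classes: "x \<le> 8 \<Longrightarrow> symb (row_class x) (col_class x) = x"
  unfolding le_8_cases by (elim disjE) (simp_all add: symb_def row_class_def col_class_def)

lemma row_class_symb: "r < 3 \<Longrightarrow> k < 3 \<Longrightarrow> row_class (symb r k) = r"
  and col_class_symb: "r < 3 \<Longrightarrow> k < 3 \<Longrightarrow> col_class (symb r k) = k"
  unfolding less_3_cases
  by (elim disjE; simp add: symb_def row_class_def col_class_def)+

text \<open>Triples as full fibres of a class function. Abstracting from the function lets one lemma
  extract the Latin family of the rows and that of the columns.\<close>

definition classifies :: "(nat \<Rightarrow> nat) \<Rightarrow> nat set set \<Rightarrow> bool" where
  "classifies h A \<longleftrightarrow> (\<forall>X\<in>A. \<forall>x\<in>X. h x < 3 \<and> X = {y. y \<le> 8 \<and> h y = h x})"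

lemma Collect_le_8: "{y. y \<le> 8 \<and> P y} = set (filter P [0..<9])"
  by auto

lemma upt_9: "[0..<9] = [0,1,2,3,4,5,6,7,8]"
  by (simp add: upt_rec)

lemma classifies_row: "classifies row_class row_triples"
  unfolding classifies_def row_triples_def Collect_le_8 upt_9
  by (simp add: row_class_def insert_commute)

lemma classifies_col: "classifies col_class col_triples"
  unfolding classifies_def col_triples_def Collect_le_8 upt_9
  by (simp add: col_class_def insert_commute)

text \<open>Three Latin squares of order 3 on top of each other: for each \<open>a\<close>, the
  square with rows \<open>strip a\<close> and columns 0, 1, 2. For the column family of a board the
  lines \<open>i\<close> are columns and \<open>c\<close> counts bands.\<close>

definition latin :: "(nat \<Rightarrow> nat \<Rightarrow> nat) \<Rightarrow> bool" where
  "latin \<rho> \<longleftrightarrow>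
     (\<forall>i\<in>{1..9}. bij_betw (\<rho> i) {..<3} {..<3}) \<and>
     (\<forall>a<3. \<forall>c<3. bij_betw (\<lambda>i. \<rho> i c) (strip a) {..<3})"

text \<open>\<open>\<rho> i c\<close> is the row triple filling row \<open>i\<close> in pillar \<open>c\<close>, and \<open>\<gamma> j a\<close> the column triple filling
  column \<open>j\<close> in band \<open>a\<close>; an entry is the common symbol of the two triples through its cell.\<close>

definition model :: "(nat \<Rightarrow> nat \<Rightarrow> nat) \<Rightarrow> (nat \<Rightarrow> nat \<Rightarrow> nat) \<Rightarrow> (nat \<Rightarrow> nat \<Rightarrow> nat) \<Rightarrow> board" where
  "model s \<rho> \<gamma> x = (if x \<in> grid then
     s (\<rho> (fst x) (strip_of (snd x))) (\<gamma> (snd x) (strip_of (fst x))) else 0)"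

lemma model_apply:
  "i \<in> {1..9} \<Longrightarrow> j \<in> {1..9} \<Longrightarrow>
    model s \<rho> \<gamma> (i, j) = s (\<rho> i (strip_of j)) (\<gamma> j (strip_of i))"
  by (simp add: model_def mem_grid)

lemma model_strip:
  "i \<in> strip a \<Longrightarrow> j \<in> strip c \<Longrightarrow> a < 3 \<Longrightarrow> c < 3 \<Longrightarrow> model s \<rho> \<gamma> (i, j) = s (\<rho> i c) (\<gamma> j a)"
  using strip_subset [of a i] strip_subset [of c j] by (simp add: model_apply mem_strip)

lemma latin_less: "latin \<rho> \<Longrightarrow> i \<in> {1..9} \<Longrightarrow> c < 3 \<Longrightarrow> \<rho> i c < 3"
  using bij_betwE unfolding latin_def by blast

section \<open>From Latin families to boards and back\<close>

lemma bij_betw_of_inj: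
  assumes "inj_on f S" "f ` S \<subseteq> T" "finite T" "card S = card T"
  shows "bij_betw f S T"
  using assms by (simp add: bij_betw_def card_image card_subset_eq)

lemma model_cong:
  assumes "\<And>i c. i \<in> {1..9} \<Longrightarrow> c < 3 \<Longrightarrow> \<rho> i c = \<rho>' i c"
    and "\<And>j a. j \<in> {1..9} \<Longrightarrow> a < 3 \<Longrightarrow> \<gamma> j a = \<gamma>' j a"
  shows "model s \<rho> \<gamma> = model s \<rho>' \<gamma>'"
proof
  fix x :: "nat \<times> nat"
  obtain i j where x: "x = (i, j)" by (cases x)
  show "model s \<rho> \<gamma> x = model s \<rho>' \<gamma>' x"
  proof (cases "x \<in> grid")
    case True
    then have "i \<in> {1..9}" "j \<in> {1..9}" unfolding x mem_grid by blast+
    then show ?thesis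
      unfolding x using assms strip_of_less by (simp add: model_apply del: atLeastAtMost_iff)
  qed (simp add: model_def)
qed

lemma model_transpose:
  "model s \<rho> \<gamma> \<circ> transpose_cells = model (\<lambda>x y. s y x) \<gamma> \<rho>"
  by (auto simp: fun_eq_iff model_def transpose_cells_def on_grid_def grid_def)

text \<open>Within a pillar, row \<open>i\<close> runs once through row \<open>\<rho> i c\<close> of
  the table \<open>s\<close>, because \<open>\<gamma>\<close> is bijective on the columns of the
  pillar. The table is arbitrary so that the columns are covered too, by the flipped table that
  transposition produces.\<close>

lemma row_magic_model:
  assumes \<rho>: "latin \<rho>" and \<gamma>: "latin \<gamma>"
    and all: "(\<Union>x<3. s x ` {..<3}) = {0..8}"
    and sums: "\<And>x. x < 3 \<Longrightarrow> (\<Sum>y<3. s x y) = 12"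
  shows "row_magic (model s \<rho> \<gamma>)"
proof -
  have bij_\<gamma>: "bij_betw (\<lambda>j. \<gamma> j a) (strip c) {..<3}" if "a < 3" "c < 3" for a c
    using \<gamma> that by (simp add: latin_def)
  have segment: "(\<lambda>j. model s \<rho> \<gamma> (i, j)) ` strip c = s (\<rho> i c) ` {..<3}"
    if "i \<in> strip a" "a < 3" "c < 3" for i a c
  proof -
    have "(\<lambda>j. model s \<rho> \<gamma> (i, j)) ` strip c = (\<lambda>j. s (\<rho> i c) (\<gamma> j a)) ` strip c"
      using that by (intro image_cong) (simp_all add: model_strip)
    also have "\<dots> = s (\<rho> i c) ` ((\<lambda>j. \<gamma> j a) ` strip c)" by (simp add: image_image)
    finally show ?thesis using bij_\<gamma> that by (simp add: bij_betw_def)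
  qed
  have row: "(\<lambda>j. model s \<rho> \<gamma> (i, j)) ` {1..9} = {0..8}" if i: "i \<in> {1..9}" for i
  proof -
    have "(\<lambda>j. model s \<rho> \<gamma> (i, j)) ` {1..9} = (\<Union>c<3. s (\<rho> i c) ` {..<3})"
      unfolding UN_strips [symmetric] image_UN
      using segment [OF in_own_strip [OF i] strip_of_less [OF i]] by simp
    also have "\<dots> = (\<Union>x\<in>\<rho> i ` {..<3}. s x ` {..<3})" by simp
    also have "\<rho> i ` {..<3} = {..<3}" using \<rho> i unfolding latin_def bij_betw_def by blast
    finally show ?thesis using all by simp
  qed
  have sum: "(\<Sum>j\<in>strip c. model s \<rho> \<gamma> (i, j)) = 12" if i: "i \<in> {1..9}" and c: "c < 3" for i c
  proof -
    have "(\<Sum>j\<in>strip c. model s \<rho> \<gamma> (i, j)) = (\<Sum>j\<in>strip c. s (\<rho> i c) (\<gamma> j (strip_of i)))"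
      using model_strip [OF in_own_strip [OF i] _ strip_of_less [OF i] c] by (intro sum.cong) simp_all
    also have "\<dots> = (\<Sum>y<3. s (\<rho> i c) y)"
      by (rule sum.reindex_bij_betw [OF bij_\<gamma> [OF strip_of_less [OF i] c]])
    finally show ?thesis using sums latin_less [OF \<rho> i c] by simp
  qed
  have block: "model s \<rho> \<gamma> ` (strip a \<times> strip c) = {0..8}" if "a < 3" "c < 3" for a c
  proof -
    have "model s \<rho> \<gamma> ` (strip a \<times> strip c) = (\<Union>i\<in>strip a. (\<lambda>j. model s \<rho> \<gamma> (i, j)) ` strip c)"
      by auto
    also have "\<dots> = (\<Union>i\<in>strip a. s (\<rho> i c) ` {..<3})"
      using segment that by simp
    also have "\<dots> = (\<Union>x\<in>(\<lambda>i. \<rho> i c) ` strip a. s x ` {..<3})" by simp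
    also have "(\<lambda>i. \<rho> i c) ` strip a = {..<3}"
      using \<rho> that unfolding latin_def bij_betw_def by blast
    finally show ?thesis using all by simp
  qed
  show ?thesis unfolding row_magic_def by (intro conjI ballI allI impI row sum block)
qed

lemma semi_magic_model:
  assumes "latin \<rho>" "latin \<gamma>"
  shows "semi_magic (model symb \<rho> \<gamma>)"
proof -
  have "{0..8} = set [0..<9::nat]" by auto
  then have 8: "{0..8} = {0,1,2,3,4,5,6,7,8::nat}" unfolding upt_9 by simp
  have "row_magic (model symb \<rho> \<gamma>)"
  proof (rule row_magic_model [OF assms])
    show "(\<Union>x<3. symb x ` {..<3}) = {0..8}" unfolding 8 lessThan_3 by (auto simp: symb_def)
  qed (auto simp: less_3_cases symb_def lessThan_3)
  moreover have "row_magic (model (\<lambda>x y. symb y x) \<gamma> \<rho>)"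
  proof (rule row_magic_model [OF assms(2,1)])
    show "(\<Union>x<3. (\<lambda>y. symb y x) ` {..<3}) = {0..8}" unfolding 8 lessThan_3 by (auto simp: symb_def)
  qed (auto simp: less_3_cases symb_def lessThan_3)
  ultimately show ?thesis by (simp add: semi_magic_iff model_transpose model_def)
qed

text \<open>The class is constant on a segment, so it is read off at the first cell, column
  \<open>3*c+1\<close>. Disjoint segments are different fibres and get different classes;
  injectivity between sets of three elements gives the bijections.\<close>

lemma latin_of_row_sets:
  assumes b: "row_magic b" and h: "classifies h A"
    and A: "\<And>i c. i \<in> {1..9} \<Longrightarrow> c < 3 \<Longrightarrow> row_set b i c \<in> A"
  defines "\<rho> \<equiv> \<lambda>i c. h (b (i, 3*c+1))"
  shows "latin \<rho>" "i \<in> {1..9} \<Longrightarrow> j \<in> {1..9} \<Longrightarrow> h (b (i, j)) = \<rho> i (strip_of j)"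
proof -
  have mem: "b (i, 3*c+1) \<in> row_set b i c" for i c by (simp add: row_set_def strip_def)
  have less: "\<rho> i c < 3" if "i \<in> {1..9}" "c < 3" for i c
    using h A [OF that] mem unfolding classifies_def \<rho>_def by blast
  have set: "row_set b i c = {y. y \<le> 8 \<and> h y = \<rho> i c}" if "i \<in> {1..9}" "c < 3" for i c
    using h A [OF that] mem unfolding classifies_def \<rho>_def by blast
  show "h (b (i, j)) = \<rho> i (strip_of j)" if "i \<in> {1..9}" "j \<in> {1..9}" for i j
  proof -
    have "b (i, j) \<in> row_set b i (strip_of j)" using in_own_strip [OF that(2)] by (simp add: row_set_def)
    then show ?thesis using set [OF that(1) strip_of_less [OF that(2)]] by simp
  qed
  have ne: "\<rho> i c \<noteq> \<rho> i' c'"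
    if "i \<in> {1..9}" "c < 3" "i' \<in> {1..9}" "c' < 3" "row_set b i c \<inter> row_set b i' c' = {}" for i c i' c'
  proof
    assume "\<rho> i c = \<rho> i' c'"
    then have "row_set b i c = row_set b i' c'" using set [OF that(1,2)] set [OF that(3,4)] by simp
    with that(5) mem [of i c] show False by simp
  qed
  show "latin \<rho>"
    unfolding latin_def
  proof (intro conjI ballI allI impI bij_betw_of_inj)
    fix i :: nat assume i: "i \<in> {1..9}"
    show "inj_on (\<rho> i) {..<3}"
    proof (rule inj_onI, rule ccontr)
      fix c c' assume c: "c \<in> {..<3}" "c' \<in> {..<3}" "\<rho> i c = \<rho> i c'" "c \<noteq> c'"
      then show False using ne [OF i _ i _ row_set_disjoint_row [OF b i _ _ c(4)]] by simp
    qed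
    show "\<rho> i ` {..<3} \<subseteq> {..<3}" using less [OF i] by blast
  next
    fix a c :: nat assume ac: "a < 3" "c < 3"
    show "inj_on (\<lambda>i. \<rho> i c) (strip a)"
    proof (rule inj_onI, rule ccontr)
      fix i i' assume i: "i \<in> strip a" "i' \<in> strip a" "\<rho> i c = \<rho> i' c" "i \<noteq> i'"
      have "i \<in> {1..9}" "i' \<in> {1..9}" using i ac strip_subset by blast+
      then show False using ne [OF _ ac(2) _ ac(2) row_set_disjoint_block [OF b ac i(1,2,4)]] i(3) by blast
    qed
    show "(\<lambda>i. \<rho> i c) ` strip a \<subseteq> {..<3}" using less strip_subset ac by blast
  qed simp_all
qed

text \<open>Row classes come from the board and column classes from its transpose. The two classes
  of an entry determine it by \<open>symb_of_classes\<close>.\<close>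

lemma semi_magic_is_model:
  assumes b: "semi_magic b" and "i0 \<in> strip 0" "row_set b i0 0 \<in> row_triples"
  obtains \<rho> \<gamma> where "latin \<rho>" "latin \<gamma>" "b = model symb \<rho> \<gamma>"
proof -
  have "dual_triples row_triples col_triples" by (simp add: dual_triples_def)
  note triples = all_triples [OF b this assms(2,3)]
  have bm: "row_magic b" "row_magic (b \<circ> transpose_cells)" using b by (auto simp: semi_magic_iff)
  note R = latin_of_row_sets [OF bm(1) classifies_row triples(1)]
  note C = latin_of_row_sets [OF bm(2) classifies_col triples(2)]
  obtain \<rho> \<gamma> where L: "latin \<rho>" "latin \<gamma>"
    and \<rho>: "\<And>i j. i \<in> {1..9} \<Longrightarrow> j \<in> {1..9} \<Longrightarrow> row_class (b (i, j)) = \<rho> i (strip_of j)"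
    and \<gamma>: "\<And>i j. i \<in> {1..9} \<Longrightarrow> j \<in> {1..9} \<Longrightarrow>
        col_class ((b \<circ> transpose_cells) (i, j)) = \<gamma> i (strip_of j)"
    using R C by blast
  have "b x = model symb \<rho> \<gamma> x" for x
  proof (cases "x \<in> grid")
    case True
    obtain i j where x: "x = (i, j)" by (cases x)
    have ij: "i \<in> {1..9}" "j \<in> {1..9}" using True by (simp_all add: x mem_grid)
    have "(\<lambda>j. b (i, j)) ` {1..9} = {0..8}" using bm(1) ij unfolding row_magic_def by blast
    then have "b (i, j) \<le> 8" using ij by (metis atLeastAtMost_iff imageI)
    moreover have "(b \<circ> transpose_cells) (j, i) = b (i, j)"
      using ij by (simp add: transpose_cells_apply mem_grid)
    ultimately show ?thesis
      using symb_of_classes \<rho> [OF ij] \<gamma> [OF ij(2,1)] model_apply [OF ij] x by metis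
  next
    case False
    moreover have "b x = 0" using b False unfolding semi_magic_iff by blast
    ultimately show ?thesis by (simp add: model_def)
  qed
  then show ?thesis using that L by blast
qed

section \<open>Latin squares of order 3 with first column 0, 1, 2\<close>

lemma derangement_3:
  fixes x y z :: nat
  assumes "x < 3" "y < 3" "z < 3" "x \<noteq> 0" "y \<noteq> 1" "z \<noteq> 2" "x \<noteq> y" "x \<noteq> z" "y \<noteq> z"
  shows "x = 1 \<and> y = 2 \<and> z = 0 \<or> x = 2 \<and> y = 0 \<and> z = 1"
  using assms by presburger

text \<open>Columns 1 and 2 differ from the first column everywhere, so each is a 3-cycle of it. Row
  0 forces the two 3-cycles to be different, and their order decides between \<open>e = 1\<close>
  and \<open>e = 2\<close>.\<close>

lemma latin_square_3:
  fixes L :: "nat \<Rightarrow> nat \<Rightarrow> nat"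
  assumes rows: "\<And>r. r < 3 \<Longrightarrow> bij_betw (L r) {..<3} {..<3}"
    and cols: "\<And>c. c < 3 \<Longrightarrow> bij_betw (\<lambda>r. L r c) {..<3} {..<3}"
    and first: "\<And>r. r < 3 \<Longrightarrow> L r 0 = r"
  shows "\<exists>e\<in>{1,2}. \<forall>r<3. \<forall>c<3. L r c = (r + e * c) mod 3"
proof -
  have less: "L r c < 3" if "r < 3" "c < 3" for r c
    using bij_betwE [OF rows [OF that(1)]] that by simp
  have row: "L r c \<noteq> L r c'" if "r < 3" "c < 3" "c' < 3" "c \<noteq> c'" for r c c'
    using inj_onD [OF bij_betw_imp_inj_on [OF rows [OF that(1)]], of c c'] that by auto
  have col: "L r c \<noteq> L r' c" if "r < 3" "r' < 3" "c < 3" "r \<noteq> r'" for r r' c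
    using inj_onD [OF bij_betw_imp_inj_on [OF cols [OF that(3)]], of r r'] that by auto
  have f: "L 0 0 = 0" "L 1 0 = 1" "L 2 0 = 2" using first by simp_all
  have deranged: "L 0 c = 1 \<and> L 1 c = 2 \<and> L 2 c = 0 \<or> L 0 c = 2 \<and> L 1 c = 0 \<and> L 2 c = 1"
    if "c < 3" "c \<noteq> 0" for c
    using less [of 0 c] less [of 1 c] less [of 2 c] row [of 0 c 0] row [of 1 c 0] row [of 2 c 0]
      col [of 0 1 c] col [of 0 2 c] col [of 1 2 c] that f by (intro derangement_3) simp_all
  have "L 0 1 = 1 \<and> L 1 1 = 2 \<and> L 2 1 = 0 \<and> L 0 2 = 2 \<and> L 1 2 = 0 \<and> L 2 2 = 1 \<or>
    L 0 1 = 2 \<and> L 1 1 = 0 \<and> L 2 1 = 1 \<and> L 0 2 = 1 \<and> L 1 2 = 2 \<and> L 2 2 = 0"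
    using deranged [of 1] deranged [of 2] row [of 0 1 2] by auto
  then show ?thesis
  proof (elim disjE)
    assume "L 0 1 = 1 \<and> L 1 1 = 2 \<and> L 2 1 = 0 \<and> L 0 2 = 2 \<and> L 1 2 = 0 \<and> L 2 2 = 1"
    then have "\<forall>r<3. \<forall>c<3. L r c = (r + 1 * c) mod 3" using f by (simp add: less_3_cases all_conj_distrib)
    then show ?thesis by blast
  next
    assume "L 0 1 = 2 \<and> L 1 1 = 0 \<and> L 2 1 = 1 \<and> L 0 2 = 1 \<and> L 1 2 = 2 \<and> L 2 2 = 0"
    then have "\<forall>r<3. \<forall>c<3. L r c = (r + 2 * c) mod 3" using f by (simp add: less_3_cases all_conj_distrib)
    then show ?thesis by blast
  qed
qed

lemma bij_betw_strip: "bij_betw (\<lambda>r. 3*a+r+1) {..<3} (strip a)"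
proof (rule bij_betw_of_inj)
  show "inj_on (\<lambda>r. 3*a+r+1) {..<3}" by (simp add: inj_on_def)
qed (auto simp: strip_def)

lemma latin_band:
  assumes \<rho>: "latin \<rho>" and a: "a < 3" and first: "\<And>i. i \<in> strip a \<Longrightarrow> \<rho> i 0 = (i - 1) mod 3"
  shows "\<exists>e\<in>{1,2}. \<forall>i\<in>strip a. \<forall>c<3. \<rho> i c = (i - 1 + e * c) mod 3"
proof -
  define L where "L r c = \<rho> (3*a+r+1) c" for r c
  have mem: "3*a+r+1 \<in> strip a" if "r < 3" for r using that by (simp add: strip_def)
  have "\<exists>e\<in>{1,2}. \<forall>r<3. \<forall>c<3. L r c = (r + e * c) mod 3"
  proof (rule latin_square_3)
    fix r :: nat assume "r < 3"
    then show "bij_betw (L r) {..<3} {..<3}"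
      using \<rho> strip_subset [OF a mem] unfolding latin_def L_def by blast
    show "L r 0 = r" using first [OF mem] \<open>r < 3\<close> by (simp add: L_def)
  next
    fix c :: nat assume "c < 3"
    then have "bij_betw (\<lambda>i. \<rho> i c) (strip a) {..<3}" using \<rho> a by (simp add: latin_def)
    from bij_betw_trans [OF bij_betw_strip this]
    show "bij_betw (\<lambda>r. L r c) {..<3} {..<3}" by (simp add: L_def o_def)
  qed
  \<comment> \<open>The offset \<open>3*a\<close> vanishes modulo 3, so the line number minus 1 may
    stand for the position inside the strip.\<close>
  moreover have "(r + e * c) mod 3 = (3*a+r+1 - 1 + e * c) mod 3" for r e c
    by (simp add: add.assoc)
  ultimately show ?thesis unfolding ball_strip L_def by metis
qed

text \<open>Both 1 and 2 are units modulo 3, so \<open>x\<close> and then \<open>e\<close> can be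
  cancelled.\<close>

lemma shift_inj:
  fixes x c c' :: nat
  assumes "e \<in> {1, 2}" "c < 3" "c' < 3" "(x + e * c) mod 3 = (x + e * c') mod 3"
  shows "c = c'"
proof -
  have "[e * c = e * c'] (mod 3)"
    using assms(4) cong_add_lcancel_nat unfolding cong_def by blast
  moreover have "coprime e 3" using assms(1) by auto
  ultimately have "[c = c'] (mod 3)" using cong_mult_lcancel_nat by blast
  then show ?thesis using assms by (simp add: cong_def)
qed

lemma bij_betw_shift_row:
  assumes "e \<in> {1, 2}"
  shows "bij_betw (\<lambda>c. (x + e * c) mod 3) {..<3} {..<3::nat}"
proof (rule bij_betw_of_inj)
  show "inj_on (\<lambda>c. (x + e * c) mod 3) {..<3}"
    by (rule inj_onI, rule shift_inj [OF assms]) (simp_all only: lessThan_iff)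
qed auto

lemma bij_betw_shift_col: "bij_betw (\<lambda>i. (i - 1 + x) mod 3) (strip a) {..<3}"
proof (rule bij_betw_of_inj)
  have "i = i'" if i: "i \<in> strip a" "i' \<in> strip a" "(i - 1 + x) mod 3 = (i' - 1 + x) mod 3" for i i'
  proof -
    obtain r r' where r: "i = 3*a+r+1" "i' = 3*a+r'+1" "r < 3" "r' < 3"
      using i(1,2) bij_betw_strip [of a] unfolding bij_betw_def by blast
    \<comment> \<open>Rewritten as a shift with factor 1 in the positions \<open>r\<close> and
      \<open>r'\<close>, to which \<open>shift_inj\<close> applies.\<close>
    have "(3*a + x + 1 * r) mod 3 = (3*a + x + 1 * r') mod 3"
      using i(3) unfolding r by (simp add: ac_simps)
    then have "r = r'" using shift_inj [of 1 r r'] r(3,4) by blast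
    then show ?thesis using r by simp
  qed
  then show "inj_on (\<lambda>i. (i - 1 + x) mod 3) (strip a)" by (rule inj_onI)
qed auto

section \<open>The rearrangement group\<close>

lemma H_Gamma_comp: "g \<in> H_Gamma \<Longrightarrow> h \<in> H_Gamma \<Longrightarrow> g \<circ> h \<in> H_Gamma"
  by (induction rule: H_Gamma.induct) (simp_all add: comp_assoc H_Gamma.H_step)

lemma H_gens_subset: "g \<in> H_gens \<Longrightarrow> g \<in> H_Gamma"
  using H_Gamma.H_step [OF _ H_Gamma.H_id] by simp

lemma transpose_in_H: "transpose_cells \<in> H_Gamma"
  by (intro H_gens_subset) (simp add: H_gens_def)

text \<open>Independent movement of rows and columns. All generators other than the transpose have
  this form.\<close>

definition cell_map :: "(nat \<Rightarrow> nat) \<Rightarrow> (nat \<Rightarrow> nat) \<Rightarrow> nat \<times> nat \<Rightarrow> nat \<times> nat" where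
  "cell_map f g = on_grid (\<lambda>(i, j). (f i, g j))"

lemma cell_map_apply:
  "i \<in> {1..9} \<Longrightarrow> j \<in> {1..9} \<Longrightarrow> cell_map f g (i, j) = (f i, g j)"
  by (simp add: cell_map_def on_grid_def mem_grid)

lemma cell_map_off_grid: "x \<notin> grid \<Longrightarrow> cell_map f g x = x"
  by (simp add: cell_map_def on_grid_def)

lemma cell_map_id: "cell_map id id = id"
  by (auto simp: cell_map_def on_grid_def)

lemma cell_map_comp:
  assumes "f' ` {1..9} \<subseteq> {1..9}" "g' ` {1..9} \<subseteq> {1..9}"
  shows "cell_map f g \<circ> cell_map f' g' = cell_map (f \<circ> f') (g \<circ> g')"
proof
  fix x :: "nat \<times> nat"
  obtain i j where x: "x = (i, j)" by (cases x)
  show "(cell_map f g \<circ> cell_map f' g') x = cell_map (f \<circ> f') (g \<circ> g') x"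
  proof (cases "x \<in> grid")
    case True
    then have ij: "i \<in> {1..9}" "j \<in> {1..9}" by (simp_all add: x mem_grid)
    then have "f' i \<in> {1..9}" "g' j \<in> {1..9}" using assms by blast+
    with ij show ?thesis unfolding x comp_apply by (simp only: cell_map_apply comp_apply)
  qed (simp add: cell_map_off_grid)
qed

text \<open>Moving a transposition past a cell map exchanges its two coordinates. This collects the
  transpositions of a product on one side.\<close>

lemma transpose_cell_map:
  assumes "f ` {1..9} \<subseteq> {1..9}" "g ` {1..9} \<subseteq> {1..9}"
  shows "transpose_cells \<circ> cell_map f g = cell_map g f \<circ> transpose_cells"
proof
  fix x :: "nat \<times> nat"
  obtain i j where x: "x = (i, j)" by (cases x)
  show "(transpose_cells \<circ> cell_map f g) x = (cell_map g f \<circ> transpose_cells) x"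
  proof (cases "x \<in> grid")
    case True
    then have ij: "i \<in> {1..9}" "j \<in> {1..9}" by (simp_all add: x mem_grid)
    then have "f i \<in> {1..9}" "g j \<in> {1..9}" using assms by blast+
    with ij show ?thesis
      unfolding x comp_apply cell_map_apply [OF ij]
      by (simp only: transpose_cells_apply mem_grid cell_map_apply simp_thms)
  qed (simp add: cell_map_off_grid transpose_off_grid)
qed

text \<open>On 1..9 these are the elements of the wreath product of two symmetric groups of degree
  3; \<open>\<pi>\<close> is the induced permutation of the strips.\<close>

definition strip_perm :: "(nat \<Rightarrow> nat) \<Rightarrow> (nat \<Rightarrow> nat) \<Rightarrow> bool" where
  "strip_perm f \<pi> \<longleftrightarrow> bij_betw \<pi> {..<3} {..<3} \<and> (\<forall>a<3. bij_betw f (strip a) (strip (\<pi> a)))"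

lemma strip_perm_less: "strip_perm f \<pi> \<Longrightarrow> a < 3 \<Longrightarrow> \<pi> a < 3"
  using bij_betwE unfolding strip_perm_def by blast

lemma strip_perm_mem: "strip_perm f \<pi> \<Longrightarrow> a < 3 \<Longrightarrow> i \<in> strip a \<Longrightarrow> f i \<in> strip (\<pi> a)"
  using bij_betwE unfolding strip_perm_def by blast

lemma strip_perm_strip_of:
  assumes "strip_perm f \<pi>" "i \<in> {1..9}"
  shows "f i \<in> {1..9}" "strip_of (f i) = \<pi> (strip_of i)"
proof -
  have "strip_of i < 3" "f i \<in> strip (\<pi> (strip_of i))"
    using strip_perm_mem [OF assms(1)] strip_of_less in_own_strip assms(2) by blast+
  then show "f i \<in> {1..9}" "strip_of (f i) = \<pi> (strip_of i)"
    using strip_subset strip_perm_less [OF assms(1)] mem_strip by blast+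
qed

lemma strip_perm_image: "strip_perm f \<pi> \<Longrightarrow> f ` {1..9} \<subseteq> {1..9}"
  using strip_perm_strip_of(1) by blast

lemma strip_perm_id: "strip_perm id id"
  by (simp add: strip_perm_def)

lemma strip_perm_comp: "strip_perm f \<pi> \<Longrightarrow> strip_perm g \<tau> \<Longrightarrow> strip_perm (f \<circ> g) (\<pi> \<circ> \<tau>)"
  unfolding strip_perm_def
proof (intro conjI allI impI; elim conjE)
  fix a :: nat
  assume "bij_betw \<tau> {..<3} {..<3}" "a < 3"
  then have "\<tau> a < 3" using bij_betwE by blast
  moreover assume "\<forall>a<3. bij_betw f (strip a) (strip (\<pi> a))" "\<forall>a<3. bij_betw g (strip a) (strip (\<tau> a))"
  ultimately show "bij_betw (f \<circ> g) (strip a) (strip ((\<pi> \<circ> \<tau>) a))"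
    using \<open>a < 3\<close> bij_betw_trans by (metis comp_apply)
qed (rule bij_betw_trans)

lemma strip_perm_permutes:
  assumes "p permutes strip a"
  shows "strip_perm p id"
  unfolding strip_perm_def
proof (intro conjI allI impI)
  fix b :: nat
  show "bij_betw p (strip b) (strip (id b))"
  proof (cases "b = a")
    case True
    then show ?thesis using assms by (simp add: permutes_imp_bij)
  next
    case False
    then have "p i = id i" if "i \<in> strip b" for i
      using assms that permutes_not_in [of p "strip a" i] by (auto simp: mem_strip)
    then have "bij_betw p (strip b) (strip b) = bij_betw id (strip b) (strip b)"
      by (rule bij_betw_cong)
    then show ?thesis by simp
  qed
qed simp

text \<open>Strips are counted from 0 and bands from 1, so bands 2 and 3 are the strips 1 and
  2.\<close>

lemma strip_perm_strip23: "strip_perm strip23 (sw 1 2)"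
  unfolding strip_perm_def
proof (intro conjI allI impI)
  show "bij_betw (sw 1 2) {..<3} {..<3}"
    by (rule bij_betw_of_inj) (auto simp: sw_def inj_on_def)
next
  fix a :: nat assume "a < 3"
  then show "bij_betw strip23 (strip a) (strip (sw 1 2 a))"
    by (intro bij_betw_of_inj) (auto simp: less_3_cases sw_def inj_on_def strip23_def strip_def)
qed

lemma strip23_in_H: "cell_map strip23 id \<in> H_Gamma" "cell_map id strip23 \<in> H_Gamma"
  by (rule H_gens_subset, simp add: H_gens_def cell_map_def band_swap23_def pillar_swap23_def)+

lemma sw_strip_perm:
  assumes "same_strip p q"
  shows "strip_perm (sw p q) id"
proof -
  have "p \<in> strip (strip_of p)" "q \<in> strip (strip_of p)"
    using assms by (auto simp: same_strip_def mem_strip strip_of_def)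
  moreover have "sw p q = transpose p q" by (auto simp: sw_def transpose_def fun_eq_iff)
  ultimately show ?thesis using strip_perm_permutes permutes_swap_id by metis
qed

text \<open>A permutation of a finite set is a product of transpositions, and each transposition
  within a strip is a generator.\<close>

lemma rows_in_H:
  assumes "p permutes strip a" "a < 3"
  shows "cell_map p id \<in> H_Gamma"
  using assms(1) finite_strip
proof (induction rule: permutes_induct)
  case id
  show ?case unfolding cell_map_id by (rule H_Gamma.H_id)
next
  case (swap i i' p)
  have same: "same_strip i i'"
    using swap(1,2) strip_subset [OF assms(2)] by (simp add: same_strip_def mem_strip strip_of_def)
  have "transpose i i' = sw i i'" by (auto simp: sw_def transpose_def fun_eq_iff)
  then have "cell_map (transpose i i' \<circ> p) id = row_swap i i' \<circ> cell_map p id"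
    using cell_map_comp [OF strip_perm_image [OF strip_perm_permutes [OF swap(4)]], of id "sw i i'" id]
    by (simp add: row_swap_def cell_map_def)
  moreover have "row_swap i i' \<in> H_gens" using same by (auto simp: H_gens_def)
  ultimately show ?case using swap(5) by (metis H_Gamma.H_step)
qed

text \<open>Conjugation by the transpose turns a rearrangement of rows into the same rearrangement
  of columns.\<close>

lemma cols_in_H:
  assumes "strip_perm f \<pi>" "cell_map f id \<in> H_Gamma"
  shows "cell_map id f \<in> H_Gamma"
proof -
  have "cell_map id f = transpose_cells \<circ> (cell_map f id \<circ> transpose_cells)"
    using transpose_cell_map [of id f] strip_perm_image [OF assms(1)]
    by (simp add: comp_assoc [symmetric] flip: transpose_cell_map)
  then show ?thesis using assms(2) transpose_in_H by (simp add: H_Gamma_comp)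
qed

section \<open>Action of rearrangements on Latin families\<close>

lemma latin_strip_perm:
  assumes \<rho>: "latin \<rho>" and f: "strip_perm f \<pi>" and \<tau>: "bij_betw \<tau> {..<3} {..<3}"
  shows "latin (\<lambda>i c. \<rho> (f i) (\<tau> c))"
  unfolding latin_def
proof (intro conjI ballI allI impI)
  fix i :: nat assume "i \<in> {1..9}"
  then have "bij_betw (\<rho> (f i)) {..<3} {..<3}"
    using \<rho> strip_perm_strip_of(1) [OF f] unfolding latin_def by blast
  from bij_betw_trans [OF \<tau> this] show "bij_betw (\<lambda>c. \<rho> (f i) (\<tau> c)) {..<3} {..<3}"
    by (simp add: o_def)
next
  fix a c :: nat assume ac: "a < 3" "c < 3"
  then have "\<tau> c < 3" using \<tau> bij_betwE by blast
  then have "bij_betw (\<lambda>i. \<rho> i (\<tau> c)) (strip (\<pi> a)) {..<3}"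
    using \<rho> strip_perm_less [OF f ac(1)] unfolding latin_def by blast
  moreover have "bij_betw f (strip a) (strip (\<pi> a))" using f ac by (simp add: strip_perm_def)
  ultimately show "bij_betw (\<lambda>i. \<rho> (f i) (\<tau> c)) (strip a) {..<3}"
    using bij_betw_trans by (fastforce simp: o_def)
qed

text \<open>A row movement \<open>f\<close> acts twice: on the lines of \<open>\<rho>\<close>, and
  through \<open>\<pi>\<close> on the band index of \<open>\<gamma>\<close>. Columns act likewise
  with the roles exchanged.\<close>

lemma model_cell_map:
  assumes f: "strip_perm f \<pi>" and g: "strip_perm g \<tau>"
  shows "model s \<rho> \<gamma> \<circ> cell_map f g = model s (\<lambda>i c. \<rho> (f i) (\<tau> c)) (\<lambda>j a. \<gamma> (g j) (\<pi> a))"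
proof
  fix x :: "nat \<times> nat"
  obtain i j where x: "x = (i, j)" by (cases x)
  show "(model s \<rho> \<gamma> \<circ> cell_map f g) x = model s (\<lambda>i c. \<rho> (f i) (\<tau> c)) (\<lambda>j a. \<gamma> (g j) (\<pi> a)) x"
  proof (cases "x \<in> grid")
    case True
    then have ij: "i \<in> {1..9}" "j \<in> {1..9}" by (simp_all add: x mem_grid)
    show ?thesis
      unfolding x comp_apply cell_map_apply [OF ij] model_apply [OF ij]
      using strip_perm_strip_of [OF f ij(1)] strip_perm_strip_of [OF g ij(2)]
      by (simp only: model_apply)
  qed (simp add: cell_map_off_grid model_def)
qed

text \<open>Each strip is sorted separately by its entries in the first column, and the three
  sorting permutations are composed.\<close>

lemma normalize_first_column:
  assumes \<rho>: "latin \<rho>"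
  obtains f where "strip_perm f id" "cell_map f id \<in> H_Gamma"
    "\<And>i. i \<in> {1..9} \<Longrightarrow> \<rho> (f i) 0 = (i - 1) mod 3"
proof -
  have "\<exists>p. p permutes strip a \<and> (\<forall>i\<in>strip a. \<rho> (p i) 0 = (i - 1) mod 3)" if a: "a < 3" for a
  proof -
    \<comment> \<open>Position \<open>i\<close> receives the line whose first entry is
      \<open>(i - 1) mod 3\<close>, found by inverting the first column.\<close>
    define p where "p = inv_into (strip a) (\<lambda>i. \<rho> i 0) \<circ> (\<lambda>i. (i - 1) mod 3)"
    have bij: "bij_betw (\<lambda>i. \<rho> i 0) (strip a) {..<3}" using \<rho> a by (simp add: latin_def)
    have "bij_betw (\<lambda>i. (i - 1) mod 3) (strip a) {..<3}"
      using bij_betw_shift_col [of 0 a] by simp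
    then have p: "bij_betw p (strip a) (strip a)"
      unfolding p_def using bij_betw_inv_into [OF bij] bij_betw_trans by blast
    have "\<rho> (p i) 0 = (i - 1) mod 3" for i
      using bij_betw_inv_into_right [OF bij, of "(i - 1) mod 3"] by (simp add: p_def)
    \<comment> \<open>\<open>permutes\<close> demands the identity outside the strip, so
      \<open>p\<close> is extended by it.\<close>
    then show ?thesis
      using bij_imp_permutes [of "\<lambda>i. if i \<in> strip a then p i else i" "strip a"] p
      by (intro exI [of _ "\<lambda>i. if i \<in> strip a then p i else i"]) (simp cong: bij_betw_cong)
  qed
  then obtain p where p: "\<And>a. a < 3 \<Longrightarrow> p a permutes strip a"
    and \<rho>p: "\<And>a i. a < 3 \<Longrightarrow> i \<in> strip a \<Longrightarrow> \<rho> (p a i) 0 = (i - 1) mod 3"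
    by metis
  define f where "f = p 0 \<circ> (p 1 \<circ> p 2)"
  have sp: "strip_perm (p a) id" if "a < 3" for a using strip_perm_permutes p that by blast
  have "strip_perm f id"
    unfolding f_def using strip_perm_comp [OF sp strip_perm_comp [OF sp sp]] by fastforce
  moreover have "cell_map f id \<in> H_Gamma"
  proof -
    have "cell_map f id = cell_map (p 0) id \<circ> (cell_map (p 1) id \<circ> cell_map (p 2) id)"
      unfolding f_def using strip_perm_image [OF sp, of 2] strip_perm_image [OF strip_perm_comp [OF sp sp], of 1 2]
      by (simp add: cell_map_comp del: image_comp)
    then show ?thesis using rows_in_H [OF p] by (simp add: H_Gamma_comp)
  qed
  moreover have "\<rho> (f i) 0 = (i - 1) mod 3" if i: "i \<in> {1..9}" for i
  proof -
    \<comment> \<open>Of the three factors only the one for the strip of \<open>i\<close> moves it;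
      the others fix both \<open>i\<close> and its image.\<close>
    have other: "p a k = k" if "a < 3" "strip_of k \<noteq> a" for a k
      using permutes_not_in [OF p [OF that(1)], of k] that by (simp add: mem_strip)
    have own: "strip_of (p a i) = a" if "a < 3" "strip_of i = a" for a
      using permutes_in_image [OF p [OF that(1)], of i] that i by (simp add: mem_strip)
    have "f i = p (strip_of i) i"
      using strip_of_less [OF i] unfolding less_3_cases f_def comp_apply
      by (elim disjE) (simp_all add: own other)
    then show ?thesis using \<rho>p in_own_strip [OF i] strip_of_less [OF i] by simp
  qed
  ultimately show ?thesis using that by blast
qed

section \<open>Boards with standard gnomon\<close>

text \<open>The standard gnomon, read off in terms of the two triple indices.\<close>

definition normal :: "(nat \<Rightarrow> nat \<Rightarrow> nat) \<Rightarrow> bool" where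
  "normal \<rho> \<longleftrightarrow>
     (\<forall>i\<in>{1..9}. \<rho> i 0 = (i - 1) mod 3) \<and>
     (\<forall>i\<in>strip 0. \<forall>c<3. \<rho> i c = (i - 1 + 2 * c) mod 3)"

lemma strip23_mod: "(strip23 i - 1) mod 3 = (i - 1) mod 3"
proof (cases "4 \<le> i")
  case True
  then obtain k where "i = k + 4" by (metis le_add_diff_inverse2)
  then show ?thesis by (auto simp: strip23_def) presburger+
qed (simp add: strip23_def)

text \<open>Swapping pillars 2 and 3 exchanges columns 1 and 2 of the square, which turns the factor
  1 into 2. The same \<open>q\<close> also permutes the lines of the other family. That it fixes the
  first strip and keeps positions inside strips preserves the normalization there.\<close>

lemma normalize_first_band:
  assumes \<rho>: "latin \<rho>" "\<And>i. i \<in> {1..9} \<Longrightarrow> \<rho> i 0 = (i - 1) mod 3"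
  obtains q \<kappa> where "strip_perm q \<kappa>" "\<kappa> 0 = 0" "cell_map q id \<in> H_Gamma" "cell_map id q \<in> H_Gamma"
    "\<And>i. i \<in> strip 0 \<Longrightarrow> q i = i" "\<And>i. i \<in> {1..9} \<Longrightarrow> (q i - 1) mod 3 = (i - 1) mod 3"
    "\<And>i c. i \<in> strip 0 \<Longrightarrow> c < 3 \<Longrightarrow> \<rho> i (\<kappa> c) = (i - 1 + 2 * c) mod 3"
proof -
  have "\<exists>e\<in>{1,2}. \<forall>i\<in>strip 0. \<forall>c<3. \<rho> i c = (i - 1 + e * c) mod 3"
    using \<rho> strip_subset [of 0] by (intro latin_band) auto
  then obtain e where "e \<in> {1, 2}" and e: "\<And>i c. i \<in> strip 0 \<Longrightarrow> c < 3 \<Longrightarrow> \<rho> i c = (i - 1 + e * c) mod 3"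
    by blast
  from this(1) have "e = 1 \<or> e = 2" by simp
  then show ?thesis
  proof
    assume [simp]: "e = 1"
    show ?thesis
    proof (rule that [OF strip_perm_strip23 _ strip23_in_H])
      show "\<rho> i (sw 1 2 c) = (i - 1 + 2 * c) mod 3" if "i \<in> strip 0" "c < 3" for i c
      proof -
        \<comment> \<open>The factor 2 at column 2 is the factor 1 at column 1, because 4 is 1
          modulo 3.\<close>
        have "(x + 2 * 2) mod 3 = (x + 1 * 1) mod 3" for x :: nat by presburger
        then have "\<rho> i (sw 1 2 2) = (i - 1 + 2 * 2) mod 3"
          using e [OF that(1), of 1] by (simp only: sw_def) simp
        moreover have "\<rho> i (sw 1 2 0) = (i - 1 + 2 * 0) mod 3" "\<rho> i (sw 1 2 1) = (i - 1 + 2 * 1) mod 3"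
          using e [OF that(1), of 0] e [OF that(1), of 2] by (simp_all add: sw_def)
        ultimately show ?thesis using that(2) less_3_cases by metis
      qed
      show "(strip23 i - 1) mod 3 = (i - 1) mod 3" for i :: nat
        by (rule strip23_mod)
    qed (auto simp: sw_def strip23_def strip_def)
  next
    assume "e = 2"
    then show ?thesis
      using e by (intro that [OF strip_perm_id]) (simp_all only: id_apply cell_map_id H_Gamma.H_id)
  qed
qed

text \<open>Two rounds: lines are sorted within strips to make both first columns standard, then
  pillars and bands 2 and 3 are swapped where the factor of a first strip is still 1.\<close>

lemma normalize_model:
  assumes "latin \<rho>" "latin \<gamma>"
  obtains \<sigma> \<rho>' \<gamma>' where "\<sigma> \<in> H_Gamma" "latin \<rho>'" "latin \<gamma>'" "normal \<rho>'" "normal \<gamma>'"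
    "model s \<rho> \<gamma> \<circ> \<sigma> = model s \<rho>' \<gamma>'"
proof -
  have id3: "bij_betw id {..<3::nat} {..<3}" by simp
  obtain f where f: "strip_perm f id" "cell_map f id \<in> H_Gamma"
    "\<And>i. i \<in> {1..9} \<Longrightarrow> \<rho> (f i) 0 = (i - 1) mod 3"
    using normalize_first_column [OF assms(1)] by metis
  obtain g where g: "strip_perm g id" "cell_map g id \<in> H_Gamma"
    "\<And>i. i \<in> {1..9} \<Longrightarrow> \<gamma> (g i) 0 = (i - 1) mod 3"
    using normalize_first_column [OF assms(2)] by metis
  define \<rho>1 where "\<rho>1 i c = \<rho> (f i) (id c)" for i c
  define \<gamma>1 where "\<gamma>1 i c = \<gamma> (g i) (id c)" for i c
  have L1: "latin \<rho>1" "latin \<gamma>1"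
    unfolding \<rho>1_def \<gamma>1_def using latin_strip_perm assms f(1) g(1) id3 by blast+
  have first: "\<rho>1 i 0 = (i - 1) mod 3" "\<gamma>1 i 0 = (i - 1) mod 3" if "i \<in> {1..9}" for i
    using f(3) [OF that] g(3) [OF that] by (simp_all add: \<rho>1_def \<gamma>1_def)
  obtain q \<kappa> where q: "strip_perm q \<kappa>" "\<kappa> 0 = 0" "cell_map id q \<in> H_Gamma"
    "\<And>i. i \<in> strip 0 \<Longrightarrow> q i = i" "\<And>i. i \<in> {1..9} \<Longrightarrow> (q i - 1) mod 3 = (i - 1) mod 3"
    "\<And>i c. i \<in> strip 0 \<Longrightarrow> c < 3 \<Longrightarrow> \<rho>1 i (\<kappa> c) = (i - 1 + 2 * c) mod 3"
    using normalize_first_band [OF L1(1) first(1)] by metis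
  obtain p \<pi> where p: "strip_perm p \<pi>" "\<pi> 0 = 0" "cell_map p id \<in> H_Gamma"
    "\<And>i. i \<in> strip 0 \<Longrightarrow> p i = i" "\<And>i. i \<in> {1..9} \<Longrightarrow> (p i - 1) mod 3 = (i - 1) mod 3"
    "\<And>i c. i \<in> strip 0 \<Longrightarrow> c < 3 \<Longrightarrow> \<gamma>1 i (\<pi> c) = (i - 1 + 2 * c) mod 3"
    using normalize_first_band [OF L1(2) first(2)] by metis
  \<comment> \<open>\<open>q\<close> is chosen for \<open>\<rho>\<close> but moves columns, the
    lines of \<open>\<gamma>\<close>; \<open>p\<close> is chosen for \<open>\<gamma>\<close> but
    moves rows, the lines of \<open>\<rho>\<close>. Neither spoils what the other achieves.\<close>
  define \<rho>2 where "\<rho>2 i c = \<rho>1 (p i) (\<kappa> c)" for i c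
  define \<gamma>2 where "\<gamma>2 i c = \<gamma>1 (q i) (\<pi> c)" for i c
  have L2: "latin \<rho>2" "latin \<gamma>2"
    unfolding \<rho>2_def \<gamma>2_def using latin_strip_perm L1 p(1) q(1) unfolding strip_perm_def by blast+
  have N: "normal \<rho>2" "normal \<gamma>2"
    unfolding normal_def \<rho>2_def \<gamma>2_def
    using first strip_perm_strip_of(1) [OF p(1)] strip_perm_strip_of(1) [OF q(1)] p q
    by (simp_all del: atLeastAtMost_iff)
  have "model s \<rho> \<gamma> \<circ> cell_map f g = model s \<rho>1 \<gamma>1"
    using model_cell_map [OF f(1) g(1)] unfolding \<rho>1_def \<gamma>1_def .
  moreover have "model s \<rho>1 \<gamma>1 \<circ> cell_map p q = model s \<rho>2 \<gamma>2"
    using model_cell_map [OF p(1) q(1)] unfolding \<rho>2_def \<gamma>2_def .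
  ultimately have "model s \<rho> \<gamma> \<circ> (cell_map f g \<circ> cell_map p q) = model s \<rho>2 \<gamma>2"
    by (simp add: comp_assoc [symmetric])
  moreover have "cell_map f g \<circ> cell_map p q \<in> H_Gamma"
  proof -
    have "cell_map u v = cell_map u id \<circ> cell_map id v" if "strip_perm v \<tau>" for u v \<tau>
      using cell_map_comp [of id v u id] strip_perm_image [OF that] by simp
    then show ?thesis
      using f(2) cols_in_H [OF g(1,2)] p(3) q(3) g(1) q(1) by (metis H_Gamma_comp)
  qed
  ultimately show ?thesis using that L2 N by blast
qed

section \<open>The standard gnomon in Latin coordinates\<close>

lemma strip_0: "strip 0 = {1, 2, 3}"
  by (auto simp: strip_def)

lemma range9: "{1..9} = {1,2,3,4,5,6,7,8,9::nat}"
  by (auto simp: numeral_eq_Suc le_Suc_eq)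

text \<open>Ties the numerical table to the shifts by a check of all 27 cells: from pillar to pillar
  the row triple advances by 2, while the column triple depends only on the position inside the
  pillar.\<close>

lemma std_gnomon_band:
  "i \<in> strip 0 \<Longrightarrow> j \<in> {1..9} \<Longrightarrow>
    std_gnomon_entry (i, j) = symb ((i - 1 + 2 * strip_of j) mod 3) ((j - 1) mod 3)"
  unfolding strip_0 range9
  by (elim insertE emptyE; hypsubst; simp add: std_gnomon_entry_def std_band_def symb_def strip_of_def)

lemma std_gnomon_pillar:
  "i \<in> {1..9} \<Longrightarrow> j \<in> strip 0 \<Longrightarrow>
    std_gnomon_entry (i, j) = symb ((i - 1) mod 3) ((j - 1 + 2 * strip_of i) mod 3)"
  unfolding strip_0 range9
  by (elim insertE emptyE; hypsubst;
      simp add: std_gnomon_entry_def std_band_def std_pillar_def symb_def strip_of_def)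

lemma gnomon_cases: "(i, j) \<in> gnomon \<longleftrightarrow> i \<in> strip 0 \<and> j \<in> {1..9} \<or> i \<in> {1..9} \<and> j \<in> strip 0"
  by (auto simp: gnomon_def strip_def)

lemma has_std_gnomon_model:
  assumes "normal \<rho>" "normal \<gamma>"
  shows "has_std_gnomon (model symb \<rho> \<gamma>)"
proof -
  have less: "strip_of i < 3" if "i \<in> {1..9}" for i using that by (rule strip_of_less)
  have sub: "i \<in> {1..9}" "strip_of i = 0" if "i \<in> strip 0" for i
    using strip_subset [OF _ that] that by (simp_all add: mem_strip)
  have "model symb \<rho> \<gamma> (i, j) = std_gnomon_entry (i, j)" if "i \<in> strip 0" "j \<in> {1..9}" for i j
    using that assms less [OF that(2)] sub [OF that(1)] unfolding normal_def
    by (simp only: model_apply std_gnomon_band)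
  moreover have "model symb \<rho> \<gamma> (i, j) = std_gnomon_entry (i, j)" if "i \<in> {1..9}" "j \<in> strip 0" for i j
    using that assms less [OF that(1)] sub [OF that(2)] unfolding normal_def
    by (simp only: model_apply std_gnomon_pillar)
  ultimately show ?thesis
    unfolding has_std_gnomon_def using gnomon_cases by (metis surj_pair)
qed

text \<open>\<open>row_class\<close> and \<open>col_class\<close> invert \<open>symb\<close>, so
  each gnomon entry determines both triple indices at its cell.\<close>

lemma normal_of_has_std_gnomon:
  assumes L: "latin \<rho>" "latin \<gamma>" and std: "has_std_gnomon (model symb \<rho> \<gamma>)"
  shows "normal \<rho>" "normal \<gamma>"
proof -
  have eq: "symb (\<rho> i (strip_of j)) (\<gamma> j (strip_of i)) = std_gnomon_entry (i, j)"
    if "i \<in> {1..9}" "j \<in> {1..9}" "i \<in> strip 0 \<or> j \<in> strip 0" for i j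
  proof -
    have "(i, j) \<in> gnomon" using that gnomon_cases by blast
    then show ?thesis using std model_apply [OF that(1,2)] unfolding has_std_gnomon_def by metis
  qed
  have less: "\<rho> i (strip_of j) < 3" "\<gamma> i (strip_of j) < 3" if "i \<in> {1..9}" "j \<in> {1..9}" for i j
    using latin_less [OF L(1) that(1)] latin_less [OF L(2) that(1)] strip_of_less [OF that(2)] by blast+
  have row: "\<rho> i (strip_of j) = r" "\<gamma> j (strip_of i) = k"
    if "i \<in> {1..9}" "j \<in> {1..9}" "i \<in> strip 0 \<or> j \<in> strip 0" "std_gnomon_entry (i, j) = symb r k" "r < 3" "k < 3"
    for i j r k
    using eq [OF that(1-3)] that(4-6) less [OF that(1,2)] less [OF that(2,1)] row_class_symb col_class_symb
    by metis+
  have sub: "i \<in> {1..9}" if "i \<in> strip 0" for i by (rule strip_subset [OF _ that]) simp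
  \<comment> \<open>One sample line per strip suffices, since the row index is the same throughout a
    pillar and the column index throughout a band.\<close>
  have start: "3*c+1 \<in> {1..9}" "strip_of (3*c+1) = c" if "c < 3" for c
    using that by (auto simp: strip_of_def)
  have 1: "1 \<in> {1..9::nat}" "1 \<in> strip 0" "strip_of 1 = 0" by (simp_all add: strip_of_def strip_def)
  have "\<rho> i 0 = (i - 1) mod 3" if "i \<in> {1..9}" for i
    using row(1) [OF that 1(1) disjI2 [OF 1(2)] std_gnomon_pillar [OF that 1(2)]] by (simp add: 1(3) [simplified])
  moreover have "\<gamma> i 0 = (i - 1) mod 3" if "i \<in> {1..9}" for i
    using row(2) [OF 1(1) that disjI1 [OF 1(2)] std_gnomon_band [OF 1(2) that]] by (simp add: 1(3) [simplified])
  moreover have "\<rho> i c = (i - 1 + 2 * c) mod 3" if "i \<in> strip 0" "c < 3" for i c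
    using row(1) [OF sub [OF that(1)] start(1) [OF that(2)] disjI1 [OF that(1)] std_gnomon_band [OF that(1) start(1) [OF that(2)]]]
    unfolding start(2) [OF that(2)] by simp
  moreover have "\<gamma> i c = (i - 1 + 2 * c) mod 3" if "i \<in> strip 0" "c < 3" for i c
    using row(2) [OF start(1) [OF that(2)] sub [OF that(1)] disjI2 [OF that(1)] std_gnomon_pillar [OF start(1) [OF that(2)] that(1)]]
    unfolding start(2) [OF that(2)] by simp
  ultimately show "normal \<rho>" "normal \<gamma>" unfolding normal_def by blast+
qed

section \<open>The sixteen standard boards\<close>

text \<open>The factor 2 for the first strip is the one prescribed by \<open>normal\<close>; \<open>e1\<close> and \<open>e2\<close> are the
  choices left open in the other two.\<close>

definition shifts :: "nat \<Rightarrow> nat \<Rightarrow> nat \<Rightarrow> nat \<Rightarrow> nat" where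
  "shifts e1 e2 i c = (i - 1 + [2, e1, e2] ! strip_of i * c) mod 3"

lemma normal_shifts: "normal (shifts e1 e2)"
  unfolding normal_def by (simp add: shifts_def mem_strip)

lemma latin_shifts:
  assumes "e1 \<in> {1, 2}" "e2 \<in> {1, 2}"
  shows "latin (shifts e1 e2)"
proof -
  have "[2, e1, e2] ! a \<in> {1, 2}" if "a < 3" for a
    using assms that unfolding less_3_cases by auto
  then have "bij_betw (shifts e1 e2 i) {..<3} {..<3}" if "i \<in> {1..9}" for i
    using bij_betw_shift_row strip_of_less [OF that] unfolding shifts_def by blast
  moreover have "bij_betw (\<lambda>i. shifts e1 e2 i c) (strip a) {..<3}" for a c
  proof -
    have "bij_betw (\<lambda>i. shifts e1 e2 i c) (strip a) {..<3} \<longleftrightarrow>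
        bij_betw (\<lambda>i. (i - 1 + [2, e1, e2] ! a * c) mod 3) (strip a) {..<3}"
      by (rule bij_betw_cong) (simp add: shifts_def mem_strip)
    then show ?thesis using bij_betw_shift_col by blast
  qed
  ultimately show ?thesis unfolding latin_def by blast
qed

text \<open>By \<open>latin_band\<close> strips 1 and 2 are shifts with some factor each; in strip 0
  the factor is fixed by \<open>normal\<close>.\<close>

lemma normal_is_shifts:
  assumes "latin \<rho>" "normal \<rho>"
  obtains e1 e2 where "e1 \<in> {1, 2}" "e2 \<in> {1, 2}"
    "\<And>i c. i \<in> {1..9} \<Longrightarrow> c < 3 \<Longrightarrow> \<rho> i c = shifts e1 e2 i c"
proof -
  have first: "\<rho> i 0 = (i - 1) mod 3" if "a < 3" "i \<in> strip a" for a i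
    using assms(2) strip_subset [OF that] unfolding normal_def by blast
  have band: "\<exists>e. e \<in> {1, 2} \<and> (\<forall>i c. i \<in> strip a \<longrightarrow> c < 3 \<longrightarrow> \<rho> i c = (i - 1 + e * c) mod 3)"
    if "a < 3" for a
    using latin_band [OF assms(1) that first [OF that]] by blast
  obtain e1 where e1: "e1 \<in> {1, 2}" "\<And>i c. i \<in> strip 1 \<Longrightarrow> c < 3 \<Longrightarrow> \<rho> i c = (i - 1 + e1 * c) mod 3"
    using exE [OF band [of 1]] by (metis less_3_cases)
  obtain e2 where e2: "e2 \<in> {1, 2}" "\<And>i c. i \<in> strip 2 \<Longrightarrow> c < 3 \<Longrightarrow> \<rho> i c = (i - 1 + e2 * c) mod 3"
    using exE [OF band [of 2]] by (metis less_3_cases)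
  have "\<rho> i c = shifts e1 e2 i c" if "i \<in> {1..9}" "c < 3" for i c
    using strip_of_less [OF that(1)] in_own_strip [OF that(1)] assms(2) e1(2) e2(2) that(2)
    unfolding less_3_cases [of "strip_of i"] normal_def shifts_def by (elim disjE) simp_all
  then show ?thesis using that e1(1) e2(1) by blast
qed

definition standard_boards :: "board set" where
  "standard_boards = {b. semi_magic b \<and> has_std_gnomon b}"

lemma standard_boards_eq:
  "standard_boards = (\<lambda>(e1, e2, d1, d2). model symb (shifts e1 e2) (shifts d1 d2)) `
     ({1, 2} \<times> {1, 2} \<times> {1, 2} \<times> {1, 2})" (is "_ = ?F ` ?E")
proof
  show "?F ` ?E \<subseteq> standard_boards"
    using semi_magic_model [OF latin_shifts latin_shifts] has_std_gnomon_model [OF normal_shifts normal_shifts]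
    unfolding standard_boards_def by fast
  show "standard_boards \<subseteq> ?F ` ?E"
  proof
    fix b assume "b \<in> standard_boards"
    then have b: "semi_magic b" "has_std_gnomon b" by (simp_all add: standard_boards_def)
    \<comment> \<open>The first three entries 0, 4, 8 of the gnomon decide for row triples in the
      rows, so the board itself, not its transpose, is a model.\<close>
    have "row_set b 1 0 = {std_gnomon_entry (1, 1), std_gnomon_entry (1, 2), std_gnomon_entry (1, 3)}"
      using b(2) unfolding row_set_def strip_0 has_std_gnomon_def by (simp add: gnomon_def)
    also have "\<dots> = {0, 4, 8}" by (simp add: std_gnomon_entry_def std_band_def)
    finally have "row_set b 1 0 \<in> row_triples" by (simp add: row_triples_def)
    then obtain \<rho> \<gamma> where L: "latin \<rho>" "latin \<gamma>" and m: "b = model symb \<rho> \<gamma>"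
      using semi_magic_is_model [OF b(1), of 1] by (auto simp: strip_0)
    note N = normal_of_has_std_gnomon [OF L b(2) [unfolded m]]
    obtain e1 e2 where e: "e1 \<in> {1, 2}" "e2 \<in> {1, 2}"
      "\<And>i c. i \<in> {1..9} \<Longrightarrow> c < 3 \<Longrightarrow> \<rho> i c = shifts e1 e2 i c"
      using normal_is_shifts [OF L(1) N(1)] by metis
    obtain d1 d2 where d: "d1 \<in> {1, 2}" "d2 \<in> {1, 2}"
      "\<And>i c. i \<in> {1..9} \<Longrightarrow> c < 3 \<Longrightarrow> \<gamma> i c = shifts d1 d2 i c"
      using normal_is_shifts [OF L(2) N(2)] by metis
    have "b = ?F (e1, e2, d1, d2)"
      unfolding m prod.case by (rule model_cong) (use e d in blast)+
    then show "b \<in> ?F ` ?E" using e d by blast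
  qed
qed

lemma card_standard_boards: "card standard_boards = 16"
proof -
  have entry: "e1 = row_class (model symb (shifts e1 e2) (shifts d1 d2) (4, 4))"
      "e2 = row_class (model symb (shifts e1 e2) (shifts d1 d2) (7, 4))"
      "d1 = col_class (model symb (shifts e1 e2) (shifts d1 d2) (4, 4))"
      "d2 = col_class (model symb (shifts e1 e2) (shifts d1 d2) (4, 7))"
    if "e1 \<in> {1, 2}" "e2 \<in> {1, 2}" "d1 \<in> {1, 2}" "d2 \<in> {1, 2}" for e1 e2 d1 d2
    using that
    by (simp_all add: model_apply shifts_def strip_of_def row_class_symb col_class_symb) auto
  have "inj_on (\<lambda>(e1, e2, d1, d2). model symb (shifts e1 e2) (shifts d1 d2))
     ({1, 2} \<times> {1, 2} \<times> {1, 2} \<times> {1, 2})"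
    by (rule inj_on_inverseI [where g = "\<lambda>b. (row_class (b (4, 4)), row_class (b (7, 4)),
          col_class (b (4, 4)), col_class (b (4, 7)))"])
      (clarsimp simp only: prod.case mem_Times_iff fst_conv snd_conv entry [symmetric] simp_thms)
  then show ?thesis
    unfolding standard_boards_eq by (simp add: card_image card_cartesian_product)
qed

section \<open>Nests\<close>

lemma H_gens_cases:
  assumes "g \<in> H_gens"
  obtains "g = transpose_cells"
  | f \<pi> where "strip_perm f \<pi>" "\<pi> 0 = 0" "g = cell_map f id"
  | f \<pi> where "strip_perm f \<pi>" "\<pi> 0 = 0" "g = cell_map id f"
proof -
  have "sw 1 2 0 = 0" by (simp add: sw_def)
  moreover have "band_swap23 = cell_map strip23 id" "pillar_swap23 = cell_map id strip23"
    by (simp_all add: band_swap23_def pillar_swap23_def cell_map_def)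
  moreover have "row_swap p q = cell_map (sw p q) id" "col_swap p q = cell_map id (sw p q)" for p q
    by (simp_all add: row_swap_def col_swap_def cell_map_def)
  ultimately show ?thesis
    using assms that strip_perm_strip23 sw_strip_perm unfolding H_gens_def
    by (auto simp del: id_apply) (metis id_apply)+
qed

lemma H_gens_involutive:
  assumes "g \<in> H_gens"
  shows "g \<circ> g = id"
proof -
  have sw: "sw p q \<circ> sw p q = id" for p q by (auto simp: sw_def fun_eq_iff)
  have s23: "strip23 \<circ> strip23 = id" by (auto simp: strip23_def fun_eq_iff)
  have rows: "cell_map f id \<circ> cell_map f id = id" "cell_map id f \<circ> cell_map id f = id"
    if "strip_perm f \<pi>" "f \<circ> f = id" for f \<pi>
    using cell_map_comp [of f id f id] cell_map_comp [of id f id f] strip_perm_image [OF that(1)] that(2)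
    by (simp_all add: cell_map_id)
  from assms show ?thesis
    unfolding H_gens_def
    using rows [OF strip_perm_strip23 s23] rows [OF sw_strip_perm sw]
    by (auto simp: band_swap23_def pillar_swap23_def row_swap_def col_swap_def cell_map_def)
qed

text \<open>\<open>H_Gamma\<close> is generated by composition alone; inverses exist because every
  generator is an involution.\<close>

lemma H_Gamma_inverse:
  assumes "\<sigma> \<in> H_Gamma"
  shows "\<exists>\<tau>\<in>H_Gamma. \<sigma> \<circ> \<tau> = id"
  using assms
proof induction
  case H_id
  then show ?case using H_Gamma.H_id by (metis comp_id)
next
  case (H_step g h)
  then obtain \<tau> where \<tau>: "\<tau> \<in> H_Gamma" "h \<circ> \<tau> = id" by blast
  have "(g \<circ> h) \<circ> (\<tau> \<circ> g) = g \<circ> (h \<circ> \<tau>) \<circ> g" by (simp only: comp_assoc)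
  also have "\<dots> = id" using \<tau>(2) H_gens_involutive [OF H_step(1)] by simp
  finally show ?case using H_Gamma_comp [OF \<tau>(1) H_gens_subset [OF H_step(1)]] by blast
qed

text \<open>Transpositions are moved to the left, where two of them cancel. The conditions at 0
  record that the first band and the first pillar stay in place up to transposition.\<close>

lemma H_Gamma_cases:
  assumes "\<sigma> \<in> H_Gamma"
  shows "\<exists>f \<pi> g \<tau>. strip_perm f \<pi> \<and> \<pi> 0 = 0 \<and> strip_perm g \<tau> \<and> \<tau> 0 = 0 \<and>
     (\<sigma> = cell_map f g \<or> \<sigma> = transpose_cells \<circ> cell_map f g)"
  using assms
proof induction
  case H_id
  show ?case using strip_perm_id cell_map_id by (metis id_apply)
next
  case (H_step h \<sigma>)
  then obtain f \<pi> g \<tau> where f: "strip_perm f \<pi>" "\<pi> 0 = 0" and g: "strip_perm g \<tau>" "\<tau> 0 = 0"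
    and \<sigma>: "\<sigma> = cell_map f g \<or> \<sigma> = transpose_cells \<circ> cell_map f g" by blast
  have comp: "cell_map u v \<circ> cell_map f g = cell_map (u \<circ> f) (v \<circ> g)" for u v
    using strip_perm_image f(1) g(1) by (intro cell_map_comp)
  \<comment> \<open>Passing the transposition makes \<open>u\<close> act on columns and
    \<open>v\<close> on rows.\<close>
  have flip: "cell_map u v \<circ> (transpose_cells \<circ> cell_map f g) = transpose_cells \<circ> cell_map (v \<circ> f) (u \<circ> g)"
    if "strip_perm u \<mu>" "strip_perm v \<nu>" for u v \<mu> \<nu>
    using transpose_cell_map [of v u] strip_perm_image that comp by (metis comp_assoc)
  show ?case
  proof (rule H_gens_cases [OF H_step(1)])
    assume "h = transpose_cells"
    then have "h \<circ> \<sigma> = transpose_cells \<circ> cell_map f g \<or> h \<circ> \<sigma> = cell_map f g"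
      using \<sigma> by (metis comp_assoc id_comp transpose_transpose)
    then show ?case using f g by blast
  next
    fix u \<mu> assume u: "strip_perm u \<mu>" "\<mu> 0 = 0" "h = cell_map u id"
    then have "h \<circ> \<sigma> = cell_map (u \<circ> f) g \<or> h \<circ> \<sigma> = transpose_cells \<circ> cell_map f (u \<circ> g)"
      using \<sigma> comp flip [OF u(1) strip_perm_id] by (metis id_comp)
    moreover have "strip_perm (u \<circ> f) (\<mu> \<circ> \<pi>)" "strip_perm (u \<circ> g) (\<mu> \<circ> \<tau>)"
      "(\<mu> \<circ> \<pi>) 0 = 0" "(\<mu> \<circ> \<tau>) 0 = 0"
      using u f g by (simp_all add: strip_perm_comp)
    ultimately show ?case using f g by metis
  next
    fix u \<mu> assume u: "strip_perm u \<mu>" "\<mu> 0 = 0" "h = cell_map id u"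
    then have "h \<circ> \<sigma> = cell_map f (u \<circ> g) \<or> h \<circ> \<sigma> = transpose_cells \<circ> cell_map (u \<circ> f) g"
      using \<sigma> comp flip [OF strip_perm_id u(1)] by (metis id_comp)
    moreover have "strip_perm (u \<circ> f) (\<mu> \<circ> \<pi>)" "strip_perm (u \<circ> g) (\<mu> \<circ> \<tau>)"
      "(\<mu> \<circ> \<pi>) 0 = 0" "(\<mu> \<circ> \<tau>) 0 = 0"
      using u f g by (simp_all add: strip_perm_comp)
    ultimately show ?case using f g by metis
  qed
qed

text \<open>\<open>\<sigma>\<close> preserves the entries on the gnomon and maps the first block to
  itself. The entries of that block are distinct, so its cells are fixed, which rules out a
  transposition. Row 1 and column 1 then force \<open>\<sigma>\<close> to be the identity.\<close>

lemma standard_board_unique: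
  assumes b: "semi_magic b" "has_std_gnomon b" and \<sigma>: "\<sigma> \<in> H_Gamma" "has_std_gnomon (b \<circ> \<sigma>)"
  shows "b \<circ> \<sigma> = b"
proof -
  have bm: "row_magic b" "row_magic (b \<circ> transpose_cells)" using b by (auto simp: semi_magic_iff)
  obtain f \<pi> g \<tau> where f: "strip_perm f \<pi>" "\<pi> 0 = 0" and g: "strip_perm g \<tau>" "\<tau> 0 = 0"
    and cases: "\<sigma> = cell_map f g \<or> \<sigma> = transpose_cells \<circ> cell_map f g"
    using H_Gamma_cases [OF \<sigma>(1)] by blast
  have agree: "b (\<sigma> (i, j)) = b (i, j)" if "(i, j) \<in> gnomon" for i j
    using b(2) \<sigma>(2) that unfolding has_std_gnomon_def comp_apply by metis
  have mem: "f i \<in> strip 0" "g i \<in> strip 0" if "i \<in> strip 0" for i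
    using strip_perm_mem [OF f(1) _ that] strip_perm_mem [OF g(1) _ that] f(2) g(2) by simp_all
  have sub: "i \<in> {1..9}" if "i \<in> strip 0" for i by (rule strip_subset [OF _ that]) simp
  have range: "f i \<in> {1..9}" "g i \<in> {1..9}" if "i \<in> {1..9}" for i
    using strip_perm_strip_of(1) f(1) g(1) that by blast+
  have inj: "i = i' \<and> j = j'"
    if "b (i, j) = b (i', j')" "i \<in> strip 0" "j \<in> strip 0" "i' \<in> strip 0" "j' \<in> strip 0" for i j i' j'
    using inj_onD [OF block_inj [OF bm(1), of 0 0], of "(i, j)" "(i', j')"] that by simp
  have one: "1 \<in> strip 0" "1 \<in> {1..9::nat}" and two: "2 \<in> strip 0" by (simp_all add: strip_def)
  have gn: "(i, j) \<in> gnomon" if "i \<in> strip 0 \<and> j \<in> {1..9} \<or> i \<in> {1..9} \<and> j \<in> strip 0" for i j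
    using that gnomon_cases by blast
  from cases show ?thesis
  proof
    assume \<sigma>_eq: "\<sigma> = cell_map f g"
    have f1: "f 1 = 1" "g 1 = 1"
      using inj [OF agree [OF gn, of 1 1, unfolded \<sigma>_eq cell_map_apply [OF one(2) one(2)]]] mem one by blast+
    \<comment> \<open>With row 1 fixed, its nine distinct entries pin down every column; column 1
      does the same for the rows.\<close>
    have g_id: "g j = j" if "j \<in> {1..9}" for j
    proof -
      have "b (1, g j) = b (1, j)"
        using agree [OF gn, of 1 j] cell_map_apply [OF one(2) that] f1 one that unfolding \<sigma>_eq by simp
      then show ?thesis using inj_onD [OF row_inj [OF bm(1) one(2)]] range that by blast
    qed
    have f_id: "f i = i" if i: "i \<in> {1..9}" for i
    proof -
      have "b (f i, 1) = b (i, 1)"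
        using agree [OF gn, of i 1] cell_map_apply [OF i one(2)] f1 one i unfolding \<sigma>_eq by simp
      then have "(b \<circ> transpose_cells) (1, f i) = (b \<circ> transpose_cells) (1, i)"
        using i range(1) [OF i] one(2) by (simp only: comp_apply transpose_cells_apply mem_grid simp_thms)
      then show ?thesis using inj_onD [OF row_inj [OF bm(2) one(2)]] range i by blast
    qed
    have "\<sigma> x = x" for x
    proof (cases "x \<in> grid")
      case True
      obtain i j where x: "x = (i, j)" by (cases x)
      have "i \<in> {1..9}" "j \<in> {1..9}" using True by (simp_all add: x mem_grid)
      then show ?thesis unfolding x \<sigma>_eq using cell_map_apply f_id g_id by metis
    qed (simp add: \<sigma>_eq cell_map_off_grid)
    then show ?thesis by (simp add: fun_eq_iff)
  next
    assume "\<sigma> = transpose_cells \<circ> cell_map f g"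
    then have "\<sigma> (i, j) = (g j, f i)" if "i \<in> {1..9}" "j \<in> {1..9}" for i j
      using that range by (simp only: comp_apply cell_map_apply transpose_cells_apply mem_grid simp_thms)
    then have eq: "b (g j, f i) = b (i, j)" if "i \<in> strip 0" "j \<in> strip 0" for i j
      using agree [OF gn] that sub by metis
    \<comment> \<open>The transposed cells (1, 1) and (1, 2) demand different values of
      \<open>f 1\<close>.\<close>
    have "f 1 = 1" using inj [OF eq [OF one(1) one(1)]] mem one by blast
    moreover have "f 1 = 2" using inj [OF eq [OF one(1) two]] mem one two by blast
    ultimately show ?thesis by simp
  qed
qed

text \<open>If the rows carry column triples, the transposed board is normalized and the
  transposition, itself in the group, is absorbed into the rearrangement.\<close>

lemma normalizable:
  assumes "semi_magic b"
  shows "\<exists>\<sigma>\<in>H_Gamma. semi_magic (b \<circ> \<sigma>) \<and> has_std_gnomon (b \<circ> \<sigma>)"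
proof -
  have *: "\<exists>\<sigma>\<in>H_Gamma. semi_magic (b \<circ> \<sigma>) \<and> has_std_gnomon (b \<circ> \<sigma>)"
    if b: "semi_magic b" "i \<in> strip 0" "row_set b i 0 \<in> row_triples" for b i
  proof -
    obtain \<rho> \<gamma> where L: "latin \<rho>" "latin \<gamma>" "b = model symb \<rho> \<gamma>"
      using semi_magic_is_model [OF b] by metis
    obtain \<sigma> \<rho>' \<gamma>' where "\<sigma> \<in> H_Gamma" "latin \<rho>'" "latin \<gamma>'" "normal \<rho>'" "normal \<gamma>'"
      "b \<circ> \<sigma> = model symb \<rho>' \<gamma>'"
      using normalize_model [OF L(1,2), of symb] L(3) by metis
    then show ?thesis using semi_magic_model has_std_gnomon_model by metis
  qed
  from assms show ?thesis
  proof (rule row_triples_or_transpose)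
    show "?thesis" if "i \<in> strip 0" "row_set b i 0 \<in> row_triples" for i
      using *[OF assms that] .
  next
    fix i assume i: "i \<in> strip 0" "row_set (b \<circ> transpose_cells) i 0 \<in> row_triples"
    obtain \<sigma> where "\<sigma> \<in> H_Gamma" "semi_magic (b \<circ> transpose_cells \<circ> \<sigma>)" "has_std_gnomon (b \<circ> transpose_cells \<circ> \<sigma>)"
      using *[OF semi_magic_transpose [OF assms] i] by blast
    then show ?thesis
      by (intro bexI [of _ "transpose_cells \<circ> \<sigma>"]) (simp_all add: comp_assoc H_Gamma_comp transpose_in_H)
  qed
qed

section \<open>Nests as equivalence classes and their number\<close>

lemma equiv_same_nest: "equiv semi_magic_boards same_nest"
proof (rule equivI)
  show "same_nest \<subseteq> semi_magic_boards \<times> semi_magic_boards"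
    by (auto simp: same_nest_def semi_magic_boards_def)
  show "refl_on semi_magic_boards same_nest"
  proof (rule refl_onI)
    show "(b, b) \<in> same_nest" if "b \<in> semi_magic_boards" for b
      using that bexI [OF _ H_Gamma.H_id, of "\<lambda>\<sigma>. b = b \<circ> \<sigma>"]
      by (simp add: same_nest_def semi_magic_boards_def act_def)
  qed
  show "sym same_nest"
  proof (rule symI)
    fix b b' assume "(b, b') \<in> same_nest"
    then obtain \<sigma> where b: "semi_magic b" "semi_magic b'" "\<sigma> \<in> H_Gamma" "b' = b \<circ> \<sigma>"
      by (auto simp: same_nest_def act_def)
    obtain \<tau> where "\<tau> \<in> H_Gamma" "\<sigma> \<circ> \<tau> = id" using H_Gamma_inverse [OF b(3)] by blast
    then have "b = b' \<circ> \<tau>" using b(4) by (simp add: comp_assoc)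
    then show "(b', b) \<in> same_nest" using b \<open>\<tau> \<in> H_Gamma\<close> by (auto simp: same_nest_def act_def)
  qed
  show "trans same_nest"
  proof (rule transI)
    fix x y z assume "(x, y) \<in> same_nest" "(y, z) \<in> same_nest"
    then obtain \<sigma> \<tau> where "semi_magic x" "semi_magic z" "\<sigma> \<in> H_Gamma" "\<tau> \<in> H_Gamma" "z = x \<circ> \<sigma> \<circ> \<tau>"
      by (auto simp: same_nest_def act_def)
    then show "(x, z) \<in> same_nest"
      using H_Gamma_comp by (auto simp: same_nest_def act_def comp_assoc)
  qed
qed

lemma same_nest_standard_eq:
  assumes "(b, b') \<in> same_nest" "has_std_gnomon b" "has_std_gnomon b'"
  shows "b = b'"
proof -
  obtain \<sigma> where "semi_magic b" "\<sigma> \<in> H_Gamma" "b' = b \<circ> \<sigma>"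
    using assms(1) by (auto simp: same_nest_def act_def)
  then show ?thesis using standard_board_unique assms(2,3) by metis
qed

lemma nest_has_unique_standard:
  assumes "N \<in> nests"
  shows "\<exists>!b. b \<in> N \<and> has_std_gnomon b"
proof -
  obtain b where b: "semi_magic b" "N = same_nest `` {b}"
    using assms by (auto simp: nests_def semi_magic_boards_def elim: quotientE)
  obtain \<sigma> where \<sigma>: "\<sigma> \<in> H_Gamma" "semi_magic (b \<circ> \<sigma>)" "has_std_gnomon (b \<circ> \<sigma>)"
    using normalizable [OF b(1)] by blast
  have "b \<circ> \<sigma> \<in> N" using b \<sigma> by (auto simp: same_nest_def act_def)
  moreover have "c = c'" if "c \<in> N" "c' \<in> N" "has_std_gnomon c" "has_std_gnomon c'" for c c'
  proof -
    have "(c, c') \<in> same_nest"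
      using that(1,2) b(2) equiv_same_nest unfolding equiv_def by (meson Image_singleton_iff symD transD)
    then show ?thesis using same_nest_standard_eq that by blast
  qed
  ultimately show ?thesis using \<sigma>(3) by blast
qed

text \<open>The standard boards are a system of representatives: inequivalent by
  \<open>same_nest_standard_eq\<close>, and present in every nest by
  \<open>nest_has_unique_standard\<close>.\<close>

lemma card_nests: "card nests = 16"
proof -
  have "bij_betw (\<lambda>b. same_nest `` {b}) standard_boards nests"
    unfolding bij_betw_def
  proof
    show "inj_on (\<lambda>b. same_nest `` {b}) standard_boards"
    proof (rule inj_onI)
      fix b b' assume b: "b \<in> standard_boards" "b' \<in> standard_boards" "same_nest `` {b} = same_nest `` {b'}"
      then have "(b, b') \<in> same_nest"
        using eq_equiv_class [OF _ equiv_same_nest]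
        by (simp add: standard_boards_def semi_magic_boards_def)
      then show "b = b'" using b same_nest_standard_eq by (simp add: standard_boards_def)
    qed
    show "(\<lambda>b. same_nest `` {b}) ` standard_boards = nests"
    proof
      show "(\<lambda>b. same_nest `` {b}) ` standard_boards \<subseteq> nests"
        by (auto simp: nests_def semi_magic_boards_def standard_boards_def intro: quotientI)
      show "nests \<subseteq> (\<lambda>b. same_nest `` {b}) ` standard_boards"
      proof
        fix N assume N: "N \<in> nests"
        then obtain b where b: "b \<in> N" "has_std_gnomon b" using nest_has_unique_standard by blast
        obtain b0 where "N = same_nest `` {b0}" using N by (auto simp: nests_def elim: quotientE)
        with b(1) have "(b0, b) \<in> same_nest" "semi_magic b" by (auto simp: same_nest_def)
        then have "N = same_nest `` {b}"
          using \<open>N = same_nest `` {b0}\<close> equiv_class_eq [OF equiv_same_nest] by blast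
        then show "N \<in> (\<lambda>b. same_nest `` {b}) ` standard_boards"
          using b(2) \<open>semi_magic b\<close> by (auto simp: standard_boards_def)
      qed
    qed
  qed
  then show ?thesis using bij_betw_same_card card_standard_boards by metis
qed

theorem theorem3p2:
  shows "(\<forall>b. semi_magic b \<longrightarrow>
            (\<exists>\<sigma>\<in>H_Gamma. semi_magic (act \<sigma> b) \<and> has_std_gnomon (act \<sigma> b)))
       \<and> card nests = 16
       \<and> (\<forall>N\<in>nests. \<exists>!b. b \<in> N \<and> has_std_gnomon b)"
  unfolding act_def using normalizable card_nests nest_has_unique_standard by blast

end
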